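(* Let $n\ge 3$. Every saturated $\Theta^2$-drawing of a graph $G$ on $n$ vertices contains at least $3n-6$ edges.
   Context: Graphs are finite and simple. In a straight-line drawing, vertices are distinct points of the plane in general position (no three on a line), not necessarily in convex position, and edges are straight-line segments; two edges cross if their relative interiors share a point. A $\Theta^2$-drawing of a graph $G$ is a straight-line drawing $\Gamma$ of $G$ for which there exists an edge-coloring $\varphi\colon E(G)\to\{1,2\}$ such that no two edges of the same color cross. A $\Theta^2$-drawing $\Gamma$ of $G$ is saturated if there are no two distinct vertices $u,v$ with $uv\notin E(G)$ such that $\Gamma$ together with the straight-line edge $uv$ is also a $\Theta^2$-drawing (for some coloring; no coloring is fixed in advance). *)

theory Defs
  imports "HOL-Analysis.Analysis"
begin

definition simple_graph :: "'a set \<Rightarrow> 'a set set \<Rightarrow> bool" where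
  "simple_graph V E \<longleftrightarrow> finite V \<and> (\<forall>e\<in>E. e \<subseteq> V \<and> card e = 2)"

(* A drawing is determined by the positions p of the vertices; p is only constrained on V.
   Here "no three on a line" is imposed on the positions of any three distinct vertices. *)
definition straight_line_drawing ::
    "'a set \<Rightarrow> 'a set set \<Rightarrow> ('a \<Rightarrow> real^2) \<Rightarrow> bool" where
  "straight_line_drawing V E p \<longleftrightarrow>
     simple_graph V E \<and> inj_on p V \<and>
     (\<forall>u\<in>V. \<forall>v\<in>V. \<forall>w\<in>V. u \<noteq> v \<and> u \<noteq> w \<and> v \<noteq> w \<longrightarrow> \<not> collinear {p u, p v, p w})"

definition edge_segment :: "('a \<Rightarrow> real^2) \<Rightarrow> 'a set \<Rightarrow> (real^2) set" where
  "edge_segment p e = convex hull (p ` e)"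

definition edges_cross :: "('a \<Rightarrow> real^2) \<Rightarrow> 'a set \<Rightarrow> 'a set \<Rightarrow> bool" where
  "edges_cross p e e' \<longleftrightarrow>
     rel_interior (edge_segment p e) \<inter> rel_interior (edge_segment p e') \<noteq> {}"

lemma edge_segment_pair: "edge_segment p {u, v} = closed_segment (p u) (p v)"
  by (simp add: edge_segment_def segment_convex_hull)

lemma edges_cross_pair:
  assumes "p u \<noteq> p v" and "p x \<noteq> p y"
  shows "edges_cross p {u, v} {x, y} \<longleftrightarrow>
           open_segment (p u) (p v) \<inter> open_segment (p x) (p y) \<noteq> {}"
  using assms by (simp add: edges_cross_def edge_segment_pair rel_interior_closed_segment)

definition theta2_drawing :: "'a set \<Rightarrow> 'a set set \<Rightarrow> ('a \<Rightarrow> real^2) \<Rightarrow> bool" where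
  "theta2_drawing V E p \<longleftrightarrow>
     straight_line_drawing V E p \<and>
     (\<exists>\<phi> :: 'a set \<Rightarrow> nat. \<phi> ` E \<subseteq> {1, 2} \<and>
        (\<forall>e\<in>E. \<forall>e'\<in>E. e \<noteq> e' \<and> \<phi> e = \<phi> e' \<longrightarrow> \<not> edges_cross p e e'))"

definition saturated_theta2_drawing ::
    "'a set \<Rightarrow> 'a set set \<Rightarrow> ('a \<Rightarrow> real^2) \<Rightarrow> bool" where
  "saturated_theta2_drawing V E p \<longleftrightarrow>
     theta2_drawing V E p \<and>
     \<not> (\<exists>u\<in>V. \<exists>v\<in>V. u \<noteq> v \<and> {u, v} \<notin> E \<and> theta2_drawing V (insert {u, v} E) p)"

end

theory Submission
  imports Defs
begin

text \<open>
  Extend the two colour classes of a saturated drawing to maximal crossing-free edge sets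
  \<open>T\<close> and \<open>T'\<close> on the point set. By saturation all edges of \<open>T\<close> and \<open>T'\<close> are already in the
  drawing, so \<open>E = T \<union> T'\<close>. If an edge of \<open>T \<inter> T'\<close> could be flipped in \<open>T\<close>, then the flipped edge would
  cross an edge of \<open>T\<close> and of \<open>T'\<close>, hence be new, and it could be added to the drawing; so no common
  edge is flippable. With \<open>n\<close> points, \<open>h\<close> of them on the hull, \<open>T\<close> and \<open>T'\<close> have \<open>3n - 3 - h\<close> edges each.
  An unflippable edge is a hull edge, or it is, at one of its ends \<open>u\<close> not on the hull, the only
  edge in some open half-plane bounded by a line through \<open>u\<close>; at most three edges at \<open>u\<close> have this
  property. Hence \<open>card (T \<inter> T') \<le> h + 3 * (n - h)\<close> and \<open>card (T \<union> T') \<ge> 3 * n - 6\<close>.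

  Euler's formula is avoided. Fix a linear functional that is injective on the points, thought of
  as horizontal: every triangle has a middle vertex, and every point that is not extreme has
  a triangle directly above it with that point in the middle, unless it lies on the upper hull,
  and similarly below. This bounds the number of triangles, hence of edges, from below.
\<close>


subsection \<open>Orientation and crossing\<close>

text \<open>Twice the signed area of the triangle; positive exactly when \<open>c\<close> lies to
  the left of the line directed from \<open>a\<close> to \<open>b\<close>.\<close>

definition ori :: "real^2 \<Rightarrow> real^2 \<Rightarrow> real^2 \<Rightarrow> real" where
  "ori a b c = (b$1 - a$1) * (c$2 - a$2) - (b$2 - a$2) * (c$1 - a$1)"

text \<open>A proper crossing: each segment has its ends strictly on opposite sides of the other's
  line. Because of strictness, edges with a common end never cross. Crossing thus becomes a sign
  condition on polynomials.\<close>

definition crosses :: "real^2 \<Rightarrow> real^2 \<Rightarrow> real^2 \<Rightarrow> real^2 \<Rightarrow> bool" where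
  "crosses a b c d \<longleftrightarrow> ori a b c * ori a b d < 0 \<and> ori c d a * ori c d b < 0"

lemma ori_rotate: "ori a b c = ori b c a"
  by (simp add: ori_def algebra_simps)

lemma ori_swap: "ori a c b = - ori a b c"
  by (simp add: ori_def algebra_simps)

lemma ori_flip: "ori b a c = - ori a b c"
  by (simp add: ori_def algebra_simps)

lemma ori_degenerate [simp]: "ori a a b = 0" "ori a b a = 0" "ori a b b = 0"
  by (simp_all add: ori_def)

lemma ori_affine:
  "ori a b ((1 - t) *\<^sub>R x + t *\<^sub>R y) = (1 - t) * ori a b x + t * ori a b y"
  by (simp add: ori_def algebra_simps)

text \<open>The three-term Grassmann-Plucker relation for the vectors from \<open>t\<close>.\<close>

lemma ori_Plucker:
  "ori t s q * ori t p r = ori t s p * ori t q r + ori t s r * ori t p q"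
  by (simp add: ori_def algebra_simps)

text \<open>On the open half-plane to the left of the line from \<open>t\<close> to
  \<open>s\<close>, the counterclockwise order around \<open>t\<close> is transitive.\<close>

lemma ori_trans:
  assumes "ori t s p > 0" "ori t s q > 0" "ori t s r > 0" "ori t p q > 0" "ori t q r > 0"
  shows "ori t p r > 0"
proof -
  have "ori t s q * ori t p r > 0"
    unfolding ori_Plucker[of t s q p r] using assms by (intro add_pos_pos mult_pos_pos)
  with assms(2) show ?thesis
    by (simp add: zero_less_mult_iff)
qed

lemma crosses_commute: "crosses a b c d \<longleftrightarrow> crosses c d a b"
  by (auto simp: crosses_def)

lemma crosses_swap: "crosses b a c d \<longleftrightarrow> crosses a b c d"
  by (simp add: crosses_def ori_flip[of a b] mult.commute)

lemma crosses_swap2: "crosses a b d c \<longleftrightarrow> crosses a b c d"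
  by (simp add: crosses_def ori_flip[of c d] mult.commute)

text \<open>Cramer's rule. The value of \<open>s\<close> is kept in the conclusion so that
  \<open>first_crossing\<close> can compare the crossings along one segment.\<close>

lemma crosses_point:
  assumes "crosses a b c d"
  obtains s t where "0 < s" "s < 1" "0 < t" "t < 1"
    "(1 - s) *\<^sub>R a + s *\<^sub>R b = (1 - t) *\<^sub>R c + t *\<^sub>R d"
    "s = ori c d a / (ori c d a - ori c d b)"
proof -
  define A B C D where "A = ori c d a" and "B = ori c d b" and "C = ori a b c" and "D = ori a b d"
  have AB: "A * B < 0" and CD: "C * D < 0"
    using assms by (auto simp: crosses_def A_def B_def C_def D_def)
  \<comment> \<open>Both sides are the cross product of \<open>d - c\<close> and
    \<open>a - b\<close>, so one denominator serves for \<open>s\<close> and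
    \<open>t\<close>.\<close>
  have eq: "A - B = D - C"
    by (simp add: A_def B_def C_def D_def ori_def algebra_simps)
  define s where "s = A / (A - B)"
  define t where "t = C / (C - D)"
  have ABn: "A - B \<noteq> 0" "C - D \<noteq> 0"
    using AB CD by (auto simp: mult_less_0_iff)
  have s: "0 < s" "s < 1"
    using AB by (auto simp: s_def mult_less_0_iff field_simps)
  have t: "0 < t" "t < 1"
    using CD by (auto simp: t_def mult_less_0_iff field_simps)
  have t': "t = - C / (A - B)"
  proof -
    have "C - D = - (A - B)" using eq by simp
    thus ?thesis unfolding t_def by (metis divide_minus_left divide_minus_right)
  qed
  have s1: "1 - s = - B / (A - B)"
    using ABn by (simp add: s_def field_simps)
  have t1: "1 - t = D / (A - B)"
  proof -
    have "D = (A - B) + C" using eq by simp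
    thus ?thesis using ABn by (simp add: t' add_divide_distrib)
  qed
  have comp: "(1 - s) * a$i + s * b$i = (1 - t) * c$i + t * d$i"
    if "- B * a$i + A * b$i = D * c$i - C * d$i" for i
  proof -
    have "(1 - s) * a$i + s * b$i = (- B * a$i + A * b$i) / (A - B)"
      unfolding s1 by (simp add: s_def add_divide_distrib diff_divide_distrib)
    also have "\<dots> = (1 - t) * c$i + t * d$i"
      unfolding that t1 by (simp add: t' add_divide_distrib diff_divide_distrib)
    finally show ?thesis .
  qed
  have "(1 - s) * a$1 + s * b$1 = (1 - t) * c$1 + t * d$1"
    by (rule comp) (simp add: A_def B_def C_def D_def ori_def algebra_simps)
  moreover have "(1 - s) * a$2 + s * b$2 = (1 - t) * c$2 + t * d$2"
    by (rule comp) (simp add: A_def B_def C_def D_def ori_def algebra_simps)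
  ultimately have "(1 - s) *\<^sub>R a + s *\<^sub>R b = (1 - t) *\<^sub>R c + t *\<^sub>R d"
    by (simp add: vec_eq_iff forall_2)
  with s t show ?thesis
    by (intro that[of s t]) (auto simp: s_def A_def B_def)
qed

lemma crosses_imp_open_segments:
  assumes "crosses a b c d"
  shows "open_segment a b \<inter> open_segment c d \<noteq> {}"
proof -
  obtain s t where st: "0 < s" "s < 1" "0 < t" "t < 1"
    "(1 - s) *\<^sub>R a + s *\<^sub>R b = (1 - t) *\<^sub>R c + t *\<^sub>R d"
    by (rule crosses_point[OF assms])
  have "a \<noteq> b" "c \<noteq> d" using assms by (auto simp: crosses_def)
  hence "(1 - s) *\<^sub>R a + s *\<^sub>R b \<in> open_segment a b \<inter> open_segment c d"
    using st by (auto simp: in_segment)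
  thus ?thesis by blast
qed

section \<open>General position and maximal crossing-free edge sets\<close>

definition gen_pos :: "(real^2) set \<Rightarrow> bool" where
  "gen_pos P \<longleftrightarrow> finite P \<and>
     (\<forall>a\<in>P. \<forall>b\<in>P. \<forall>c\<in>P. a \<noteq> b \<longrightarrow> a \<noteq> c \<longrightarrow> b \<noteq> c \<longrightarrow> ori a b c \<noteq> 0)"

definition edges_on :: "(real^2) set \<Rightarrow> (real^2) set set" where
  "edges_on P = {{a, b} | a b. a \<in> P \<and> b \<in> P \<and> a \<noteq> b}"

definition plane_on :: "(real^2) set \<Rightarrow> (real^2) set set \<Rightarrow> bool" where
  "plane_on P A \<longleftrightarrow> A \<subseteq> edges_on P \<and>
     (\<forall>a b c d. {a, b} \<in> A \<longrightarrow> {c, d} \<in> A \<longrightarrow> \<not> crosses a b c d)"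

text \<open>Defined by maximality alone, without faces; the triangular faces are recovered later
  through \<open>corner\<close>.\<close>

definition triangulation :: "(real^2) set \<Rightarrow> (real^2) set set \<Rightarrow> bool" where
  "triangulation P T \<longleftrightarrow> gen_pos P \<and> plane_on P T \<and>
     (\<forall>a\<in>P. \<forall>b\<in>P. a \<noteq> b \<longrightarrow> {a, b} \<notin> T \<longrightarrow> (\<exists>c d. {c, d} \<in> T \<and> crosses a b c d))"

text \<open>The affine function \<open>ori a b\<close> vanishes at the common point, so it has
  opposite signs at \<open>c\<close> and \<open>d\<close> or vanishes at both. The latter would, by
  general position, put \<open>c\<close> and \<open>d\<close> into \<open>{a, b}\<close> and make
  the edges equal. The same holds with the roles exchanged.\<close>

lemma open_segments_imp_crosses:
  assumes gp: "gen_pos P" and P: "a \<in> P" "b \<in> P" "c \<in> P" "d \<in> P"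
    and ne: "{a, b} \<noteq> {c, d}"
    and s: "0 < s" "s < 1" and t: "0 < t" "t < 1" and ab: "a \<noteq> b" and cd: "c \<noteq> d"
    and eq: "(1 - s) *\<^sub>R a + s *\<^sub>R b = (1 - t) *\<^sub>R c + t *\<^sub>R d"
  shows "crosses a b c d"
proof -
  have o: "ori x y z \<noteq> 0" if "x \<in> P" "y \<in> P" "z \<in> P" "x \<noteq> y" "x \<noteq> z" "y \<noteq> z" for x y z
    using gp that by (auto simp: gen_pos_def)
  have e1: "(1 - t) * ori a b c + t * ori a b d = 0"
    using ori_affine[of a b s a b] ori_affine[of a b t c d] eq by simp
  have e2: "(1 - s) * ori c d a + s * ori c d b = 0"
    using ori_affine[of c d t c d] ori_affine[of c d s a b] eq by simp
  have key: "x * y < 0" if "(1 - k) * x + k * y = 0" "x \<noteq> 0" "0 < k" "k < 1" for x y k :: real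
  proof -
    define m where "m = (1 - k) / k"
    have m: "m > 0" using that by (simp add: m_def)
    have "y = - (m * x)" using that by (simp add: m_def field_simps)
    hence "x * y = - (m * (x * x))" by simp
    moreover have "x * x > 0" using that(2) by (metis not_real_square_gt_zero)
    hence "m * (x * x) > 0" using m by (rule mult_pos_pos[rotated])
    ultimately show ?thesis by linarith
  qed
  have z0: "x = 0 \<longleftrightarrow> y = 0" if "(1 - k) * x + k * y = 0" "0 < k" "k < 1" for x y k :: real
    using that key[of k x y] by (cases "x = 0") auto
  have "ori a b c \<noteq> 0"
  proof
    assume "ori a b c = 0"
    moreover from this have "ori a b d = 0" using z0[OF e1] t by simp
    ultimately have "c = a \<or> c = b" "d = a \<or> d = b"
      using o[of a b c] o[of a b d] P ab by auto
    thus False using ne cd by auto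
  qed
  moreover have "ori c d a \<noteq> 0"
  proof
    assume "ori c d a = 0"
    moreover from this have "ori c d b = 0" using z0[OF e2] s by simp
    ultimately have "a = c \<or> a = d" "b = c \<or> b = d"
      using o[of c d a] o[of c d b] P cd by auto
    thus False using ne ab by auto
  qed
  ultimately show ?thesis
    using key[OF e1] key[OF e2] s t by (auto simp: crosses_def)
qed

subsection \<open>Visibility in maximal crossing-free edge sets\<close>

lemma ori_eq_0_param:
  assumes "ori a b y = 0" "a \<noteq> b"
  obtains g where "y = (1 - g) *\<^sub>R a + g *\<^sub>R b"
proof -
  have eq: "(b$1 - a$1) * (y$2 - a$2) = (b$2 - a$2) * (y$1 - a$1)"
    using assms(1) by (simp add: ori_def)
  consider "b$1 \<noteq> a$1" | "b$2 \<noteq> a$2"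
    using assms(2) by (auto simp: vec_eq_iff forall_2)
  thus ?thesis
  proof cases
    case 1
    define g where "g = (y$1 - a$1) / (b$1 - a$1)"
    have g1: "y$1 - a$1 = g * (b$1 - a$1)" using 1 by (simp add: g_def)
    moreover have "(b$1 - a$1) * (y$2 - a$2) = (b$1 - a$1) * (g * (b$2 - a$2))"
      using eq unfolding g1 by (simp add: mult_ac)
    hence "y$2 - a$2 = g * (b$2 - a$2)" using 1 by simp
    ultimately have "y = (1 - g) *\<^sub>R a + g *\<^sub>R b"
      by (simp add: vec_eq_iff forall_2 algebra_simps)
    thus ?thesis by (rule that)
  next
    case 2
    define g where "g = (y$2 - a$2) / (b$2 - a$2)"
    have g1: "y$2 - a$2 = g * (b$2 - a$2)" using 2 by (simp add: g_def)
    moreover have "(b$2 - a$2) * (y$1 - a$1) = (b$2 - a$2) * (g * (b$1 - a$1))"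
      using eq[symmetric] unfolding g1 by (simp add: mult_ac)
    hence "y$1 - a$1 = g * (b$1 - a$1)" using 2 by simp
    ultimately have "y = (1 - g) *\<^sub>R a + g *\<^sub>R b"
      by (simp add: vec_eq_iff forall_2 algebra_simps)
    thus ?thesis by (rule that)
  qed
qed

lemma finite_edges_on: "finite P \<Longrightarrow> finite (edges_on P)"
  by (rule finite_subset[of _ "Pow P"]) (auto simp: edges_on_def)

lemma edges_on_pair: "{a, b} \<in> edges_on P \<longleftrightarrow> a \<in> P \<and> b \<in> P \<and> a \<noteq> b"
  by (auto simp: edges_on_def doubleton_eq_iff)

locale triang =
  fixes P :: "(real^2) set" and T :: "(real^2) set set"
  assumes triang: "triangulation P T"
begin

lemma finite_P: "finite P"
  using triang by (simp add: triangulation_def gen_pos_def)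

lemma gen_pos_P: "gen_pos P"
  using triang by (simp add: triangulation_def)

lemma ori_neq_0:
  "\<lbrakk>a \<in> P; b \<in> P; c \<in> P; a \<noteq> b; a \<noteq> c; b \<noteq> c\<rbrakk> \<Longrightarrow> ori a b c \<noteq> 0"
  using gen_pos_P by (auto simp: gen_pos_def)

lemma edgeD:
  assumes "{a, b} \<in> T"
  shows "a \<in> P" "b \<in> P" "a \<noteq> b"
  using assms triang edges_on_pair by (auto simp: triangulation_def plane_on_def)

lemma no_cross: "{a, b} \<in> T \<Longrightarrow> {c, d} \<in> T \<Longrightarrow> \<not> crosses a b c d"
  using triang by (auto simp: triangulation_def plane_on_def)

lemma maximal:
  assumes "a \<in> P" "b \<in> P" "a \<noteq> b" "\<And>c d. {c, d} \<in> T \<Longrightarrow> \<not> crosses a b c d"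
  shows "{a, b} \<in> T"
  using triang assms unfolding triangulation_def by blast

lemma finite_T: "finite T"
  using triang finite_edges_on[OF finite_P]
  by (auto simp: triangulation_def plane_on_def intro: finite_subset)

lemma open_edges_disjoint:
  assumes "{a, b} \<in> T" "{c, d} \<in> T" "{a, b} \<noteq> {c, d}" "0 < s" "s < 1" "0 < t" "t < 1"
    "(1 - s) *\<^sub>R a + s *\<^sub>R b = (1 - t) *\<^sub>R c + t *\<^sub>R d"
  shows False
  using open_segments_imp_crosses[OF gen_pos_P, of a b c d s t] no_cross[of a b c d]
    edgeD[OF assms(1)] edgeD[OF assms(2)] assms by blast

text \<open>By maximality some edge crosses the segment from \<open>u\<close> to \<open>q\<close>;
  there are finitely many, so one has the smallest crossing parameter. Minimality is stated for
  common points of open segments, the form in which \<open>visible_neighbour\<close> consumes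
  it.\<close>

lemma first_crossing:
  assumes u: "u \<in> P" and q: "q \<in> P" and uq: "u \<noteq> q" and nT: "{u, q} \<notin> T"
  obtains r s \<tau> t where "{r, s} \<in> T" "crosses u q r s" "0 < \<tau>" "\<tau> < 1" "0 < t" "t < 1"
    "(1 - \<tau>) *\<^sub>R u + \<tau> *\<^sub>R q = (1 - t) *\<^sub>R r + t *\<^sub>R s"
    "\<And>c d k m. \<lbrakk>{c, d} \<in> T; 0 < k; k < 1; 0 < m; m < 1;
        (1 - k) *\<^sub>R u + k *\<^sub>R q = (1 - m) *\<^sub>R c + m *\<^sub>R d\<rbrakk> \<Longrightarrow> \<tau> \<le> k"
proof -
  define C where "C = {(c, d). {c, d} \<in> T \<and> crosses u q c d}"
  define h where "h = (\<lambda>(c, d). ori c d u / (ori c d u - ori c d q))"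
  have "C \<subseteq> P \<times> P" using edgeD by (auto simp: C_def)
  hence fin: "finite C" using finite_P finite_subset by blast
  have "C \<noteq> {}" using maximal[OF u q uq] nT by (auto simp: C_def)
  then obtain r s where rs: "(r, s) \<in> C" and "h (r, s) = Min (h ` C)"
    using obtains_MIN[OF fin] by (metis surj_pair)
  hence min: "h (r, s) \<le> h x" if "x \<in> C" for x
    using that fin by simp
  have rsT: "{r, s} \<in> T" and X: "crosses u q r s" using rs by (auto simp: C_def)
  obtain \<tau> t where \<tau>t: "0 < \<tau>" "\<tau> < 1" "0 < t" "t < 1"
    "(1 - \<tau>) *\<^sub>R u + \<tau> *\<^sub>R q = (1 - t) *\<^sub>R r + t *\<^sub>R s" "\<tau> = h (r, s)"
    using crosses_point[OF X] unfolding h_def by auto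
  show ?thesis
  proof (rule that[OF rsT X \<tau>t(1-5)])
    fix c d k m
    assume cd: "{c, d} \<in> T" and k: "0 < k" "k < 1" and m: "0 < m" "m < (1::real)"
      and eq: "(1 - k) *\<^sub>R u + k *\<^sub>R q = (1 - m) *\<^sub>R c + m *\<^sub>R d"
    have X': "crosses u q c d"
      using open_segments_imp_crosses[OF gen_pos_P u q _ _ _ k m uq _ eq] edgeD[OF cd] cd nT by metis
    have "(1 - k) * ori c d u + k * ori c d q = 0"
      using ori_affine[of c d k u q] ori_affine[of c d m c d] eq by simp
    hence "ori c d u = k * (ori c d u - ori c d q)"
      by (simp add: algebra_simps)
    moreover have "ori c d u - ori c d q \<noteq> 0"
      using X' by (auto simp: crosses_def mult_less_0_iff)
    ultimately have "k = h (c, d)" by (simp add: h_def field_simps)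
    moreover have "(c, d) \<in> C" using cd X' by (simp add: C_def)
    ultimately show "\<tau> \<le> k" using min \<tau>t(6) by simp
  qed
qed

text \<open>
  Turn the ray from \<open>u\<close> through the first hit \<open>x\<close> towards \<open>r\<close>; the first point \<open>p\<close> it meets in the triangle
  \<open>u\<close>, \<open>x\<close>, \<open>r\<close> is visible from \<open>u\<close>, because an edge crossing \<open>{u, p}\<close> would have to leave the empty part
  of the triangle through \<open>{u, x}\<close>, contradicting the choice of \<open>x\<close>, or through \<open>{r, s}\<close>.
\<close>

lemma visible_neighbour:
  assumes u: "u \<in> P" and q: "q \<in> P" and uq: "u \<noteq> q" and rs: "{r, s} \<in> T"
    and X: "crosses u q r s" and \<tau>: "0 < \<tau>" "\<tau> < 1" and t: "0 < t" "t < 1"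
    and x: "(1 - \<tau>) *\<^sub>R u + \<tau> *\<^sub>R q = (1 - t) *\<^sub>R r + t *\<^sub>R s"
    and min: "\<And>c d k m. \<lbrakk>{c, d} \<in> T; 0 < k; k < 1; 0 < m; m < 1;
        (1 - k) *\<^sub>R u + k *\<^sub>R q = (1 - m) *\<^sub>R c + m *\<^sub>R d\<rbrakk> \<Longrightarrow> \<tau> \<le> k"
  obtains w where "{u, w} \<in> T" "ori u q r * ori u q w > 0" "w = r \<or> ori u q r * ori u w r > 0"
proof -
  have rP: "r \<in> P" and sP: "s \<in> P" and rs_ne: "r \<noteq> s" using edgeD[OF rs] by auto
  \<comment> \<open>The sign makes the side of \<open>r\<close> the positive one, so that the lemma
    can be applied to either end of the edge.\<close>
  define \<sigma> where "\<sigma> = sgn (ori u q r)"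
  define B where "B = (\<lambda>a b. \<sigma> * ori u a b)"
  have qr_ne: "ori u q r \<noteq> 0" using X by (auto simp: crosses_def)
  have Bqr: "B q r > 0" using qr_ne by (simp add: B_def \<sigma>_def sgn_mult_self_eq mult_sgn_abs sgn_real_def)
  have Bpos: "ori u q r * ori u a b > 0 \<longleftrightarrow> B a b > 0" for a b
    using qr_ne by (auto simp: B_def \<sigma>_def sgn_real_def zero_less_mult_iff)
  have B_aff: "B a ((1 - l) *\<^sub>R y + l *\<^sub>R z) = (1 - l) * B a y + l * B a z" for a l y z
    unfolding B_def ori_affine by (simp add: algebra_simps)
  have B_anti: "B b a = - B a b" for a b
    by (simp add: B_def ori_swap[of u a b])
  have B_u: "B a u = 0" "B a a = 0" for a by (simp_all add: B_def)
  have B_nz: "B a b \<noteq> 0" if "a \<in> P" "b \<in> P" "a \<noteq> b" "a \<noteq> u" "b \<noteq> u" for a b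
    using ori_neq_0[OF u that(1,2)] that qr_ne by (auto simp: B_def \<sigma>_def sgn_real_def)
  have B_Pl: "B a b * B c d = B a c * B b d + B a d * B c b" for a b c d
    using arg_cong[OF ori_Plucker[of u a b c d], of "\<lambda>x. \<sigma> * \<sigma> * x"]
    by (simp add: B_def algebra_simps)
  define D where "D = ori r s u"
  have D: "D \<noteq> 0" using X by (auto simp: crosses_def D_def)
  \<comment> \<open>The affine function that is 0 at \<open>u\<close> and 1 on the line through
    \<open>r\<close> and \<open>s\<close>.\<close>
  define L where "L = (\<lambda>w. 1 - ori r s w / D)"
  have L_aff: "L ((1 - l) *\<^sub>R y + l *\<^sub>R z) = (1 - l) * L y + l * L z" for l y z
    unfolding L_def ori_affine by (simp add: algebra_simps add_divide_distrib diff_divide_distrib)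
  have L_vals: "L u = 0" "L r = 1" "L s = 1" using D by (simp_all add: L_def D_def)
  have Lq: "\<tau> * L q = 1"
    using L_aff[of \<tau> u q] L_aff[of t r s] x L_vals by simp
  \<comment> \<open>The points of \<open>P\<close> in the triangle \<open>u\<close>,
    \<open>x\<close>, \<open>r\<close> that are not on the side from \<open>u\<close> to
    \<open>x\<close>.\<close>
  define M where "M = {w \<in> P. B q w > 0 \<and> L w \<le> 1 \<and> B w r \<ge> 0}"
  have "r \<in> M" using rP Bqr L_vals B_u by (simp add: M_def)
  hence "M \<noteq> {}" by blast
  have fin: "finite M" using finite_P by (simp add: M_def)
  \<comment> \<open>Writing \<open>w - u\<close> in the basis \<open>q - u\<close>,
    \<open>r - u\<close>, this is the ratio of the two coordinates. Its maximum is attained in the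
    direction closest to that of \<open>q\<close>.\<close>
  obtain p where pM: "p \<in> M"
    and "Max ((\<lambda>w. B w r / B q w) ` M) = B p r / B q p"
    by (rule obtains_MAX[OF fin \<open>M \<noteq> {}\<close>])
  hence pmax: "B w r / B q w \<le> B p r / B q p" if "w \<in> M" for w
    using that fin by (metis (no_types, lifting) Max_ge finite_imageI image_eqI)
  have pP: "p \<in> P" and Bqp: "B q p > 0" and Lp: "L p \<le> 1" and Bpr: "B p r \<ge> 0"
    using pM by (auto simp: M_def)
  have pmin: "B p w \<ge> 0" if "w \<in> M" for w
  proof -
    have "B q w > 0" using that by (simp add: M_def)
    hence "B w r * B q p \<le> B p r * B q w"
      using pmax[OF that] Bqp by (simp add: divide_simps mult.commute)
    moreover have "B p w * B q r = B q w * B p r - B q p * B w r"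
      using B_Pl[of p w q r] B_anti[of p q] by (simp add: algebra_simps)
    ultimately have "B p w * B q r \<ge> 0" by (simp add: mult.commute)
    thus ?thesis using Bqr by (simp add: zero_le_mult_iff)
  qed
  have pu: "p \<noteq> u" and pq: "p \<noteq> q" using Bqp B_u by auto
  have "{u, p} \<in> T"
  proof (rule ccontr)
    assume "{u, p} \<notin> T"
    then obtain c' d' where "{c', d'} \<in> T" "crosses u p c' d'"
      using maximal[OF u pP] pu by metis
    hence "\<exists>c d. {c, d} \<in> T \<and> crosses u p c d \<and> B p c < 0"
    proof (cases "B p c' < 0")
      case True
      thus ?thesis using \<open>{c', d'} \<in> T\<close> \<open>crosses u p c' d'\<close> by blast
    next
      case False
      have "ori u p c' * ori u p d' < 0" using \<open>crosses u p c' d'\<close> by (simp add: crosses_def)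
      moreover have "ori u q r * ori u p c' \<ge> 0"
        using False qr_ne by (auto simp: B_def \<sigma>_def sgn_real_def mult_less_0_iff not_less zero_le_mult_iff split: if_splits)
      ultimately have "B p d' < 0"
        using qr_ne by (auto simp: B_def \<sigma>_def sgn_real_def mult_less_0_iff zero_le_mult_iff)
      moreover have "{d', c'} \<in> T" "crosses u p d' c'"
        using \<open>{c', d'} \<in> T\<close> \<open>crosses u p c' d'\<close> by (simp_all add: insert_commute crosses_swap2)
      ultimately show ?thesis by blast
    qed
    then obtain c d where cd: "{c, d} \<in> T" and Xc: "crosses u p c d" and Bpc: "B p c < 0" by blast
    obtain k m where k: "0 < k" "k < 1" and m: "0 < m" "m < 1"
      and z_eq: "(1 - k) *\<^sub>R u + k *\<^sub>R p = (1 - m) *\<^sub>R c + m *\<^sub>R d"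
      using crosses_point[OF Xc] by metis
    define z where "z = (1 - k) *\<^sub>R u + k *\<^sub>R p"
    have z_cd: "z = (1 - m) *\<^sub>R c + m *\<^sub>R d" using z_eq by (simp add: z_def)
    have cP: "c \<in> P" using edgeD[OF cd] by simp
    have c_ne: "c \<noteq> u" "c \<noteq> p" using Bpc B_u by auto
    have Bpz: "B p z = 0" unfolding z_def B_aff by (simp add: B_u)
    have Bqz: "B q z > 0" unfolding z_def B_aff using k Bqp by (simp add: B_u)
    have "k * L p \<le> k" using mult_left_mono[OF Lp, of k] k by simp
    hence "k * L p < 1" using k by linarith
    hence Lz: "L z < 1" unfolding z_def L_aff by (simp add: L_vals)
    have ne: "{c, d} \<noteq> {r, s}"
    proof
      assume "{c, d} = {r, s}"
      hence "L c = 1" "L d = 1" using L_vals by (auto simp: doubleton_eq_iff)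
      hence "L z = 1" unfolding z_cd L_aff by simp
      thus False using Lz by simp
    qed
    \<comment> \<open>\<open>c\<close> lies on the \<open>q\<close> side of the line through
      \<open>u\<close> and \<open>p\<close>, where by the choice of \<open>p\<close> there is no
      candidate. So it is on or past the line \<open>u q\<close>, or past the line
      \<open>r s\<close>.\<close>
    have out: "B q c \<le> 0 \<or> L c > 1"
    proof (rule ccontr)
      assume "\<not> ?thesis"
      hence 1: "B q c > 0" "L c \<le> 1" by auto
      have "B c r < 0" using pmin[of c] Bpc cP 1 unfolding M_def by (smt (verit, best) mem_Collect_eq)
      hence rc: "B r c > 0" by (simp add: B_anti[of r c])
      show False
      proof (cases "p = r")
        case True
        thus ?thesis using rc Bpc by simp
      next
        case False
        have "r \<noteq> u" using Bqr B_u by auto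
        hence "B p r > 0" using B_nz[OF pP rP] False pu Bpr by fastforce
        hence "B q r * B p c > 0"
          using B_Pl[of q r p c] Bqp rc 1 by (simp add: add_pos_pos)
        thus False using Bqr Bpc by (simp add: zero_less_mult_iff)
      qed
    qed
    \<comment> \<open>A walk along the offending edge, from its point \<open>z\<close> on the
      segment \<open>u p\<close> to its end \<open>c\<close>.\<close>
    define Y where "Y = (\<lambda>l. (1 - l) *\<^sub>R z + l *\<^sub>R c)"
    have Y_cd: "Y l = (1 - (1 - l) * m) *\<^sub>R c + ((1 - l) * m) *\<^sub>R d" for l
      unfolding Y_def z_cd by (simp add: algebra_simps)
    have Y_in: "0 < (1 - l) * m" "(1 - l) * m < 1" if "0 < l" "l < 1" for l
    proof -
      show "0 < (1 - l) * m" using that m by simp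
      have "(1 - l) * m < 1 * 1" using that m by (intro mult_strict_mono) auto
      thus "(1 - l) * m < 1" by simp
    qed
    have BpY: "B p (Y l) = l * B p c" for l unfolding Y_def B_aff by (simp add: Bpz)
    \<comment> \<open>The times at which the walk reaches the lines \<open>u q\<close> and
      \<open>r s\<close>. The value 2 lies after the end of the walk at time 1 and stands for
      never.\<close>
    define l1 where "l1 = (if B q c \<le> 0 then B q z / (B q z - B q c) else 2)"
    define l2 where "l2 = (if L c > 1 then (1 - L z) / (L c - L z) else 2)"
    have l1: "0 < l1" "B q c \<le> 0 \<Longrightarrow> l1 \<le> 1" "B q c \<le> 0 \<Longrightarrow> B q (Y l1) = 0"
    proof -
      show "0 < l1" using Bqz by (auto simp: l1_def)
      assume 1: "B q c \<le> 0"
      show "l1 \<le> 1" using Bqz 1 by (simp add: l1_def)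
      have "l1 * (B q z - B q c) = B q z" using Bqz 1 by (simp add: l1_def)
      thus "B q (Y l1) = 0" unfolding Y_def B_aff by (simp add: algebra_simps)
    qed
    have l2: "0 < l2" "L c > 1 \<Longrightarrow> l2 < 1" "L c > 1 \<Longrightarrow> L (Y l2) = 1"
    proof -
      show "0 < l2" using Lz by (auto simp: l2_def)
      assume 1: "L c > 1"
      show "l2 < 1" using Lz 1 by (simp add: l2_def)
      have "l2 * (L c - L z) = 1 - L z" using Lz 1 by (simp add: l2_def)
      thus "L (Y l2) = 1" unfolding Y_def L_aff by (simp add: algebra_simps)
    qed
    show False
    proof (cases "l1 \<le> l2")
      \<comment> \<open>The line \<open>u q\<close> is reached first, at a parameter
        \<open>h\<close> with 0 < \<open>h\<close> \<le> \<open>\<tau>\<close>. Minimality of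
        \<open>\<tau>\<close> forces equality, so the edge passes through \<open>x\<close>, an
        interior point of the different edge \<open>{r, s}\<close>.\<close>
      case True
      have Bqc: "B q c \<le> 0"
        using True out l2 by (auto simp: l1_def split: if_splits)
      have LY: "L (Y l1) \<le> 1"
      proof (cases "L c > 1")
        case True
        have "L z + l1 * (L c - L z) \<le> L z + l2 * (L c - L z)"
          using \<open>l1 \<le> l2\<close> True Lz by (simp add: mult_right_mono)
        moreover have "L (Y l) = L z + l * (L c - L z)" for l
          unfolding Y_def L_aff by (simp add: algebra_simps)
        ultimately show ?thesis using l2(3)[OF True] by simp
      next
        case False
        have "(1 - l1) * L z + l1 * L c \<le> (1 - l1) * 1 + l1 * 1"
          using False Lz l1(1) l1(2)[OF Bqc] by (intro add_mono mult_left_mono) auto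
        thus ?thesis unfolding Y_def L_aff by simp
      qed
      have "ori u q (Y l1) = 0" using l1(3)[OF Bqc] qr_ne by (simp add: B_def \<sigma>_def sgn_real_def split: if_splits)
      then obtain h where h: "Y l1 = (1 - h) *\<^sub>R u + h *\<^sub>R q"
        using ori_eq_0_param uq by metis
      have "h * B p q < 0"
        using BpY[of l1] l1(1) Bpc B_aff[of p h u q] unfolding h by (simp add: B_u mult_pos_neg)
      hence h0: "h > 0" using Bqp B_anti[of p q] by (simp add: zero_less_mult_iff)
      have "h * L q \<le> 1" using LY L_aff[of h u q] unfolding h by (simp add: L_vals)
      moreover have "L q = 1 / \<tau>" using Lq \<tau> by (simp add: field_simps)
      ultimately have h\<tau>: "h \<le> \<tau>" using \<tau> by (simp add: field_simps)
      \<comment> \<open>At time 1 the walk is at \<open>c\<close>. Were \<open>c\<close> on the line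
        \<open>u q\<close>, it would equal \<open>q\<close> by general position, but
        \<open>q\<close> lies strictly past the line \<open>r s\<close>.\<close>
      have "l1 < 1"
      proof (rule ccontr)
        assume "\<not> l1 < 1"
        hence "l1 = 1" using l1(2)[OF Bqc] by simp
        hence Yc: "Y l1 = c" by (simp add: Y_def)
        hence "B q c = 0" using l1(3)[OF Bqc] by simp
        hence "c = q" using B_nz[OF q cP] c_ne uq by auto
        hence "L q \<le> 1" using LY Yc by simp
        moreover have "L q > 1" using \<open>L q = 1 / \<tau>\<close> \<tau> by simp
        ultimately show False by simp
      qed
      note in' = Y_in[OF l1(1) this]
      have eqh: "(1 - h) *\<^sub>R u + h *\<^sub>R q = (1 - (1 - l1) * m) *\<^sub>R c + ((1 - l1) * m) *\<^sub>R d"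
        using h Y_cd by simp
      have "\<tau> \<le> h" using min[OF cd h0 _ in' eqh] h\<tau> \<tau> by simp
      hence "h = \<tau>" using h\<tau> by simp
      thus False
        using open_edges_disjoint[OF cd rs ne in' t] eqh x by simp
    next
      case False
      \<comment> \<open>The line \<open>r s\<close> is reached first, at a parameter
        \<open>g\<close>. The signs of \<open>B q\<close> and \<open>B p\<close> there give 0 <
        \<open>g\<close> < \<open>t\<close>, so the edge meets the interior of \<open>{r, s}\<close>
        between \<open>r\<close> and \<open>x\<close>.\<close>
      have Lc: "L c > 1" using False out l1 by (auto simp: l2_def split: if_splits)
      have l21: "l2 < l1" using False by simp
      have BqY: "B q (Y l2) > 0"
      proof (cases "B q c \<le> 0")
        case True
        have "l2 * (B q z - B q c) < l1 * (B q z - B q c)"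
          using l21 True Bqz by (intro mult_strict_right_mono) auto
        moreover have "B q (Y l) = B q z - l * (B q z - B q c)" for l
          unfolding Y_def B_aff by (simp add: algebra_simps)
        ultimately show ?thesis using l1(3)[OF True] by simp
      next
        case False
        thus ?thesis unfolding Y_def B_aff using l2(1) l2(2)[OF Lc] Bqz
          by (intro add_pos_pos mult_pos_pos) auto
      qed
      have "ori r s (Y l2) = 0" using l2(3)[OF Lc] D by (simp add: L_def)
      then obtain g where g: "Y l2 = (1 - g) *\<^sub>R r + g *\<^sub>R s"
        using ori_eq_0_param rs_ne by metis
      have "B q ((1 - t) *\<^sub>R r + t *\<^sub>R s) = 0"
        unfolding x[symmetric] B_aff by (simp add: B_u)
      hence Bqs: "t * B q s = - (1 - t) * B q r" unfolding B_aff by (simp add: algebra_simps)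
      have "(1 - g) * B q r + g * B q s > 0" using BqY unfolding g B_aff .
      hence "t * ((1 - g) * B q r + g * B q s) > 0" using t by simp
      moreover have "t * ((1 - g) * B q r + g * B q s) = t * (1 - g) * B q r + g * (t * B q s)"
        by (simp add: algebra_simps)
      ultimately have "(t - g) * B q r > 0" unfolding Bqs by (simp add: algebra_simps)
      hence g1: "g < t" using Bqr by (simp add: zero_less_mult_iff)
      have "(1 - t) * B p r + t * B p s = \<tau> * B p q"
        using B_aff[of p t r s] B_aff[of p \<tau> u q] x by (simp add: B_u)
      also have "\<dots> < 0" using \<tau> Bqp B_anti[of p q] by (simp add: mult_pos_neg)
      finally have "t * B p s < 0" using Bpr t by (smt (verit) mult_nonneg_nonneg)
      hence Bps: "B p s < 0" using t by (simp add: mult_less_0_iff)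
      have "(1 - g) * B p r + g * B p s < 0"
        using BpY[of l2] l2(1) Bpc unfolding g B_aff by (simp add: mult_pos_neg)
      hence g0: "g > 0"
        using Bps Bpr by (smt (verit) mult_nonneg_nonneg mult_nonpos_nonpos)
      have "g < 1" using g1 t by simp
      thus False
        using open_edges_disjoint[OF cd rs ne Y_in[OF l2(1) l2(2)[OF Lc]] g0] g Y_cd by simp
    qed
  qed
  moreover have "p = r \<or> B p r > 0"
  proof -
    have "r \<noteq> u" using Bqr B_u by auto
    thus ?thesis using B_nz[OF pP rP] pu Bpr by fastforce
  qed
  ultimately show ?thesis using that Bpos Bqp by metis
qed

end

section \<open>Half-planes, cones and angular order at a point\<close>

definition perp :: "real^2 \<Rightarrow> real^2" where
  "perp x = vector [- (x$2), x$1]"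

text \<open>With \<open>perp\<close> as the counterclockwise quarter turn, the side tests for lines
  through \<open>u\<close> become half-plane conditions.\<close>

lemma perp_inner: "perp (v - u) \<bullet> (w - u) = ori u v w"
  by (simp add: perp_def ori_def inner_vec_def sum_2 algebra_simps)

text \<open>Cramer's rule for \<open>w - u\<close> in the basis \<open>q - u\<close>,
  \<open>z - u\<close>, followed by the functional \<open>d\<close>.\<close>

lemma ori_inner:
  "ori u q z * (d \<bullet> (w - u)) = ori u w z * (d \<bullet> (q - u)) + ori u q w * (d \<bullet> (z - u))"
  by (simp add: ori_def inner_vec_def sum_2 algebra_simps)

lemma ori_perp:
  "ori u w a * (d \<bullet> d) = (d \<bullet> (w - u)) * (perp d \<bullet> (a - u)) - (perp d \<bullet> (w - u)) * (d \<bullet> (a - u))"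
  by (simp add: ori_def perp_def inner_vec_def sum_2 algebra_simps)

text \<open>The areas \<open>ori v a p\<close>, \<open>ori a u p\<close>, \<open>ori u v p\<close>
  are the unnormalised barycentric coordinates of \<open>p\<close>; the affine function
  \<open>ori r s\<close> is evaluated through them.\<close>

lemma ori_barycentric:
  "ori u v a * ori r s p = ori v a p * ori r s u + ori a u p * ori r s v + ori u v p * ori r s a"
  by (simp add: ori_def algebra_simps)

lemma inner_affine:
  "d \<bullet> (((1 - t) *\<^sub>R x + t *\<^sub>R y) - u) = (1 - t) * (d \<bullet> (x - u)) + t * (d \<bullet> (y - u))"
  for d :: "'a::real_inner"
  by (simp add: inner_diff_right inner_add_right algebra_simps)

text \<open>The first two hypotheses place \<open>w\<close> in the cone at \<open>u\<close> spanned
  by \<open>q\<close> and \<open>z\<close>. The factor \<open>ori u q z\<close> makes them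
  independent of the side on which \<open>z\<close> lies.\<close>

lemma cone_pos:
  assumes "ori u q z * ori u q w > 0" "w = z \<or> ori u q z * ori u w z > 0"
    and q: "d \<bullet> (q - u) > 0" and z: "d \<bullet> (z - u) > 0"
  shows "d \<bullet> (w - u) > 0"
  using assms(2)
proof
  assume "w = z"
  thus ?thesis using z by simp
next
  assume 1: "ori u q z * ori u w z > 0"
  have "(ori u q z * ori u q z) * (d \<bullet> (w - u)) =
      (ori u q z * ori u w z) * (d \<bullet> (q - u)) + (ori u q z * ori u q w) * (d \<bullet> (z - u))"
    using arg_cong[OF ori_inner[of u q z d w], of "\<lambda>x. ori u q z * x"]
    by (simp add: algebra_simps)
  also have "\<dots> > 0" using mult_pos_pos[OF 1 q] mult_pos_pos[OF assms(1) z] by simp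
  finally show ?thesis by (auto simp: zero_less_mult_iff)
qed

text \<open>Inside an open half-plane at \<open>u\<close> the slope \<open>f\<close> orders the
  directions by angle; its minimum is the most clockwise element and its maximum the most
  counterclockwise.\<close>

lemma extreme_angle:
  assumes fin: "finite N" and ne: "N \<noteq> {}" and pos: "\<And>w. w \<in> N \<Longrightarrow> d \<bullet> (w - u) > 0"
  shows "\<exists>a\<in>N. \<forall>w\<in>N. ori u w a \<le> 0" and "\<exists>b\<in>N. \<forall>w\<in>N. ori u b w \<le> 0"
proof -
  define f where "f = (\<lambda>w. (perp d \<bullet> (w - u)) / (d \<bullet> (w - u)))"
  have le: "ori u w a \<le> 0" if "w \<in> N" "a \<in> N" "f a \<le> f w" for w a
  proof -
    have "d \<noteq> 0" using pos[OF that(1)] by auto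
    hence d: "d \<bullet> d > 0" by simp
    have "(perp d \<bullet> (a - u)) * (d \<bullet> (w - u)) \<le> (perp d \<bullet> (w - u)) * (d \<bullet> (a - u))"
      using that(3) pos[OF that(1)] pos[OF that(2)] by (simp add: f_def divide_simps mult.commute)
    hence "ori u w a * (d \<bullet> d) \<le> 0" unfolding ori_perp by (simp add: mult.commute)
    thus ?thesis using d by (simp add: mult_le_0_iff)
  qed
  obtain a where a: "a \<in> N" "Min (f ` N) = f a" by (rule obtains_MIN[OF fin ne])
  have "f a \<le> f w" if "w \<in> N" for w
    using that fin a(2) by (metis Min_le finite_imageI image_eqI)
  thus "\<exists>a\<in>N. \<forall>w\<in>N. ori u w a \<le> 0" using a le by blast
  obtain b where b: "b \<in> N" "Max (f ` N) = f b" by (rule obtains_MAX[OF fin ne])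
  have "f w \<le> f b" if "w \<in> N" for w
    using that fin b(2) by (metis Max_ge finite_imageI image_eqI)
  thus "\<exists>b\<in>N. \<forall>w\<in>N. ori u b w \<le> 0" using b le by blast
qed

context triang begin

lemma edge_sym: "{a, b} \<in> T \<Longrightarrow> {b, a} \<in> T"
  by (simp add: insert_commute)

lemma finite_nbrs: "finite {w. {u, w} \<in> T}"
  by (rule finite_subset[OF _ finite_P]) (auto dest: edgeD)

text \<open>\<open>visible_neighbour\<close> applied to both ends of the first edge hit on the way
  to \<open>q\<close>.\<close>

lemma cone_neighbour:
  assumes u: "u \<in> P" and q: "q \<in> P" and uq: "u \<noteq> q" and nT: "{u, q} \<notin> T"
  obtains r s where "{r, s} \<in> T" "crosses u q r s"
    "\<And>z. z \<in> {r, s} \<Longrightarrow> \<exists>w. {u, w} \<in> T \<and> ori u q z * ori u q w > 0 \<and> (w = z \<or> ori u q z * ori u w z > 0)"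
proof -
  obtain r s \<tau> t where rs: "{r, s} \<in> T" "crosses u q r s" and \<tau>: "0 < \<tau>" "\<tau> < 1" and t: "0 < t" "t < 1"
    and eq: "(1 - \<tau>) *\<^sub>R u + \<tau> *\<^sub>R q = (1 - t) *\<^sub>R r + t *\<^sub>R s"
    and min: "\<And>c d k m. \<lbrakk>{c, d} \<in> T; 0 < k; k < 1; 0 < m; m < 1;
        (1 - k) *\<^sub>R u + k *\<^sub>R q = (1 - m) *\<^sub>R c + m *\<^sub>R d\<rbrakk> \<Longrightarrow> \<tau> \<le> k"
    by (rule first_crossing[OF u q uq nT]) blast
  have t': "0 < 1 - t" "1 - t < 1" using t by auto
  have eq': "(1 - \<tau>) *\<^sub>R u + \<tau> *\<^sub>R q = (1 - (1 - t)) *\<^sub>R s + (1 - t) *\<^sub>R r"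
    using eq by (simp add: add.commute)
  have 1: "\<exists>w. {u, w} \<in> T \<and> ori u q r * ori u q w > 0 \<and> (w = r \<or> ori u q r * ori u w r > 0)"
    by (rule visible_neighbour[OF u q uq rs \<tau> t eq]) (blast intro: min)+
  have "crosses u q s r" using rs(2) by (simp add: crosses_swap2)
  hence 2: "\<exists>w. {u, w} \<in> T \<and> ori u q s * ori u q w > 0 \<and> (w = s \<or> ori u q s * ori u w s > 0)"
    by (rule visible_neighbour[OF u q uq edge_sym[OF rs(1)] _ \<tau> t' eq']) (blast intro: min)+
  show ?thesis by (rule that[OF rs]) (use 1 2 in auto)
qed

text \<open>The passage from all points to neighbours. If \<open>q\<close> is not adjacent to
  \<open>u\<close>, the crossing point of the edge found in front of it lies in the half-plane,
  hence so does one end of that edge. The neighbour supplied for that end lies in the cone spanned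
  by it and \<open>q\<close>.\<close>

lemma halfplane_neighbour:
  assumes u: "u \<in> P" and q: "q \<in> P" and d: "d \<bullet> (q - u) > 0"
  shows "\<exists>w. {u, w} \<in> T \<and> d \<bullet> (w - u) > 0"
proof (cases "{u, q} \<in> T")
  case True
  thus ?thesis using d by blast
next
  case False
  have "u \<noteq> q" using d by auto
  then obtain r s where "{r, s} \<in> T" and X: "crosses u q r s"
    and vis: "\<And>z. z \<in> {r, s} \<Longrightarrow> \<exists>w. {u, w} \<in> T \<and> ori u q z * ori u q w > 0 \<and> (w = z \<or> ori u q z * ori u w z > 0)"
    using cone_neighbour[OF u q _ False] by metis
  obtain k t where k: "0 < k" "k < 1" and t: "0 < t" "t < 1"
    and eq: "(1 - k) *\<^sub>R u + k *\<^sub>R q = (1 - t) *\<^sub>R r + t *\<^sub>R s"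
    using crosses_point[OF X] by metis
  have "(1 - t) * (d \<bullet> (r - u)) + t * (d \<bullet> (s - u)) = k * (d \<bullet> (q - u))"
    using inner_affine[of d k u q u] inner_affine[of d t r s u] eq by simp
  also have "\<dots> > 0" using k d by simp
  finally have "d \<bullet> (r - u) > 0 \<or> d \<bullet> (s - u) > 0"
    using t by (smt (verit) mult_nonneg_nonpos)
  then obtain z where "z \<in> {r, s}" "d \<bullet> (z - u) > 0" by blast
  thus ?thesis using vis cone_pos d by blast
qed

subsection \<open>Facial triangles\<close>

text \<open>
  Neighbours of \<open>p\<close> that are consecutive in the angular order. By maximality \<open>p\<close>, \<open>q\<close>, \<open>r\<close> then span a
  triangular face: see \<open>corner_empty\<close> and \<open>corner_rotate\<close>.
\<close>

definition corner :: "real^2 \<Rightarrow> real^2 \<Rightarrow> real^2 \<Rightarrow> bool" where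
  "corner p q r \<longleftrightarrow> {p, q} \<in> T \<and> {p, r} \<in> T \<and> ori p q r > 0 \<and>
     (\<forall>w. {p, w} \<in> T \<longrightarrow> \<not> (ori p q w > 0 \<and> ori p w r > 0))"

lemma corner_exists:
  assumes uv: "{u, v} \<in> T" and q: "q \<in> P" "ori u v q > 0"
  shows "\<exists>a. corner u v a"
proof -
  define N where "N = {w. {u, w} \<in> T \<and> ori u v w > 0}"
  have "finite N" using finite_nbrs[of u] by (auto simp: N_def intro: finite_subset)
  moreover have "N \<noteq> {}"
    using halfplane_neighbour[of u q "perp (v - u)"] edgeD[OF uv] q
    by (auto simp: perp_inner N_def)
  moreover have "perp (v - u) \<bullet> (w - u) > 0" if "w \<in> N" for w
    using that by (simp add: perp_inner N_def)
  ultimately obtain a where "a \<in> N" "\<forall>w\<in>N. ori u w a \<le> 0"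
    using extreme_angle(1)[of N "perp (v - u)" u] by blast
  hence "corner u v a" using uv by (force simp: corner_def N_def)
  thus ?thesis by blast
qed

lemma corner_unique:
  assumes "corner p q r" "corner p q r'"
  shows "r = r'"
proof (rule ccontr)
  assume ne: "r \<noteq> r'"
  have E: "{p, q} \<in> T" "{p, r} \<in> T" "{p, r'} \<in> T" "ori p q r > 0" "ori p q r' > 0"
    using assms by (auto simp: corner_def)
  hence "ori p r r' \<noteq> 0"
    using ori_neq_0[of p r r'] ne edgeD[OF E(1)] edgeD[OF E(2)] edgeD[OF E(3)] by auto
  hence "ori p r r' > 0 \<or> ori p r' r > 0" by (auto simp: ori_swap[of p r' r])
  thus False using assms E unfolding corner_def by blast
qed

text \<open>A point \<open>p\<close> inside is not adjacent to \<open>u\<close>, so some edge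
  \<open>{r, s}\<close> separates it from \<open>u\<close>. Neither end lies in the open cone at
  \<open>u\<close>, since otherwise \<open>u\<close> would have a neighbour strictly between
  \<open>v\<close> and \<open>a\<close>. So the edge spans the cone, and as it crosses neither
  \<open>u v\<close> nor \<open>u a\<close>, neither \<open>v\<close> nor \<open>a\<close> is
  strictly on the other side of its line from \<open>u\<close>. Then neither is \<open>p\<close>, a
  contradiction.\<close>

lemma corner_empty:
  assumes C: "corner u v a" and p: "p \<in> P"
  shows "\<not> (ori u v p > 0 \<and> ori v a p > 0 \<and> ori a u p > 0)"
proof
  assume in_tri: "ori u v p > 0 \<and> ori v a p > 0 \<and> ori a u p > 0"
  have uv: "{u, v} \<in> T" and ua: "{u, a} \<in> T" and uva: "ori u v a > 0"
    and no: "\<And>w. {u, w} \<in> T \<Longrightarrow> \<not> (ori u v w > 0 \<and> ori a u w > 0)"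
    using C by (auto simp: corner_def ori_rotate[of a u])
  have up: "u \<noteq> p" using in_tri by auto
  have uP: "u \<in> P" and vP: "v \<in> P" and aP: "a \<in> P" using edgeD[OF uv] edgeD[OF ua] by auto
  have "{u, p} \<notin> T" using no in_tri by blast
  from cone_neighbour[OF uP p up this]
  obtain r0 s0 where 0: "{r0, s0} \<in> T" "crosses u p r0 s0"
    and vis0: "\<And>z. z \<in> {r0, s0} \<Longrightarrow> \<exists>w. {u, w} \<in> T \<and> ori u p z * ori u p w > 0 \<and> (w = z \<or> ori u p z * ori u w z > 0)"
    by metis
  obtain r s where rs: "{r, s} \<in> T" and X: "crosses u p r s" and rs_set: "{r, s} = {r0, s0}"
    and r: "ori u p r < 0" and s: "ori u p s > 0"
  proof (cases "ori u p r0 < 0")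
    case True
    moreover from this have "ori u p s0 > 0" using 0 by (auto simp: crosses_def mult_less_0_iff)
    ultimately show ?thesis using that[of r0 s0] 0 by blast
  next
    case False
    hence "ori u p r0 > 0" "ori u p s0 < 0" using 0 by (auto simp: crosses_def mult_less_0_iff)
    thus ?thesis using that[of s0 r0] 0 by (simp add: crosses_swap2 insert_commute)
  qed
  have vis: "\<exists>w. {u, w} \<in> T \<and> ori u p z * ori u p w > 0 \<and> (w = z \<or> ori u p z * ori u w z > 0)"
    if "z \<in> {r, s}" for z using vis0 that rs_set by blast
  have outside: "\<not> (ori u v z > 0 \<and> ori a u z > 0)" if z: "z \<in> {r, s}" for z
  proof
    assume zc: "ori u v z > 0 \<and> ori a u z > 0"
    obtain w where w: "{u, w} \<in> T" "ori u p z * ori u p w > 0" "w = z \<or> ori u p z * ori u w z > 0"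
      using vis[OF z] by blast
    have "ori u v w > 0"
      using cone_pos[OF w(2,3), of "perp (v - u)"] zc in_tri by (simp add: perp_inner)
    moreover have "ori a u w > 0"
      using cone_pos[OF w(2,3), of "- perp (a - u)"] zc in_tri
      by (simp add: perp_inner ori_flip[of u a])
    ultimately show False using no w(1) by blast
  qed
  have rP: "r \<in> P" and sP: "s \<in> P" using edgeD[OF rs] by auto
  have r_ne: "r \<noteq> u" "s \<noteq> u" using r s by auto
  have "ori u v r \<le> 0"
  proof (rule ccontr)
    assume "\<not> ?thesis"
    hence 1: "ori u v r > 0" by simp
    have "ori u r p > 0" "ori u p a > 0" using r in_tri by (auto simp: ori_swap[of u r p] ori_rotate[of a u])
    hence "ori u r a > 0" using ori_trans[of u v r p a] 1 in_tri uva by simp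
    thus False using outside[of r] 1 by (simp add: ori_rotate[of a u])
  qed
  moreover have "ori a u s \<le> 0"
  proof (rule ccontr)
    assume "\<not> ?thesis"
    hence 1: "ori a u s > 0" by simp
    have "ori u v s > 0"
    proof -
      have "ori u p a * ori u v s = ori u v a * ori u p s + ori u v p * ori u s a"
        using ori_Plucker[of u p s v a] by (simp add: ori_def algebra_simps)
      also have "\<dots> > 0" using uva s in_tri 1 by (intro add_pos_pos mult_pos_pos) (auto simp: ori_rotate[of a u])
      finally show ?thesis using in_tri by (simp add: zero_less_mult_iff ori_rotate[of a u])
    qed
    thus False using outside[of s] 1 by simp
  qed
  moreover
  obtain k t where k: "0 < k" "k < 1" and t: "0 < t" "t < 1"
    and eq: "(1 - k) *\<^sub>R u + k *\<^sub>R p = (1 - t) *\<^sub>R r + t *\<^sub>R s"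
    using crosses_point[OF X] by metis
  have "(1 - t) * ori u v r + t * ori u v s = k * ori u v p"
    using ori_affine[of u v k u p] ori_affine[of u v t r s] eq by simp
  moreover have "(1 - t) * ori a u r + t * ori a u s = k * ori a u p"
    using ori_affine[of a u k u p] ori_affine[of a u t r s] eq by simp
  moreover have "k * ori u v p > 0" "k * ori a u p > 0" using k in_tri by auto
  ultimately have vs: "ori u v r \<le> 0" "ori u v s > 0" and as: "ori a u r > 0" "ori a u s \<le> 0"
    using t by (smt (verit) mult_nonneg_nonpos)+
  have "ori r s u * ori r s v \<ge> 0"
  proof (cases "r = v")
    case False
    hence "ori u v r < 0"
      using vs(1) ori_neq_0[OF uP vP rP] edgeD[OF uv] r_ne by (metis order_le_less)
    thus ?thesis using no_cross[OF uv rs] vs by (auto simp: crosses_def mult_less_0_iff not_less zero_le_mult_iff)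
  qed simp
  moreover have "ori r s u * ori r s a \<ge> 0"
  proof (cases "s = a")
    case False
    hence "ori a u s < 0"
      using as(2) ori_neq_0[OF aP uP sP] edgeD[OF ua] r_ne by (metis order_le_less)
    thus ?thesis using no_cross[OF edge_sym[OF ua] rs] as
      by (auto simp: crosses_def mult_less_0_iff not_less zero_le_mult_iff)
  qed simp
  moreover have "ori r s u * ori r s u \<ge> 0" by simp
  ultimately have "ori v a p * (ori r s u * ori r s u) + ori a u p * (ori r s u * ori r s v)
      + ori u v p * (ori r s u * ori r s a) \<ge> 0"
    using in_tri by - (intro add_nonneg_nonneg; rule mult_nonneg_nonneg; simp)
  moreover have "ori v a p * (ori r s u * ori r s u) + ori a u p * (ori r s u * ori r s v)
      + ori u v p * (ori r s u * ori r s a) = ori u v a * (ori r s u * ori r s p)"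
    using arg_cong[OF ori_barycentric[of u v a r s p], of "\<lambda>x. ori r s u * x"]
    by (simp add: algebra_simps)
  moreover have "ori r s u * ori r s p < 0" using X by (simp add: crosses_def)
  hence "ori u v a * (ori r s u * ori r s p) < 0" using uva by (simp add: mult_pos_neg)
  ultimately show False by linarith
qed

text \<open>A segment that enters a triangle through the side \<open>v a\<close> and crosses no
  other side must end inside. Otherwise the three terms of the barycentric identity for
  \<open>ori c d\<close>, evaluated at its zero \<open>d\<close>, would all have the same
  sign.\<close>

lemma segment_ends_in_triangle:
  assumes P: "u \<in> P" "v \<in> P" "a \<in> P" "c \<in> P" "d \<in> P" and uva: "ori u v a > 0"
    and ne: "u \<noteq> c" "u \<noteq> d" and X: "crosses v a c d" and d: "ori v a d > 0"
    and nX: "\<not> crosses u v c d" "\<not> crosses u a c d"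
  shows "ori u v d > 0 \<and> ori a u d > 0"
proof (rule ccontr)
  assume out: "\<not> ?thesis"
  have cd: "c \<noteq> d" "d \<noteq> v" "d \<noteq> a" using X by (auto simp: crosses_def)
  have uva_ne: "u \<noteq> v" "u \<noteq> a" using uva by auto
  have nz: "ori u v d \<noteq> 0" "ori a u d \<noteq> 0" "ori c d u \<noteq> 0"
    using ori_neq_0 P ne cd uva_ne by auto
  obtain k t where k: "0 < k" "k < 1" and t: "0 < t" "t < 1"
    and eq: "(1 - k) *\<^sub>R v + k *\<^sub>R a = (1 - t) *\<^sub>R c + t *\<^sub>R d"
    using crosses_point[OF X] by metis
  have "(1 - t) * ori u v c + t * ori u v d = k * ori u v a"
    using ori_affine[of u v k v a] ori_affine[of u v t c d] eq by simp
  also have "\<dots> > 0" using k uva by simp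
  finally have A: "ori u v d < 0 \<Longrightarrow> ori u v c > 0" using t by (smt (verit) mult_nonneg_nonpos)
  have "(1 - t) * ori a u c + t * ori a u d = (1 - k) * ori a u v"
    using ori_affine[of a u k v a] ori_affine[of a u t c d] eq by simp
  also have "\<dots> > 0" using k uva by (simp add: ori_rotate[of a u])
  finally have B: "ori a u d < 0 \<Longrightarrow> ori a u c > 0" using t by (smt (verit) mult_nonneg_nonpos)
  have A': "ori u v d < 0 \<Longrightarrow> ori c d u * ori c d v \<ge> 0"
    using A nX(1) by (auto simp: crosses_def mult_less_0_iff not_less zero_le_mult_iff)
  have B': "ori a u d < 0 \<Longrightarrow> ori c d u * ori c d a \<ge> 0"
    using B nX(2) by (auto simp: crosses_def mult_less_0_iff not_less zero_le_mult_iff ori_flip[of u a])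
  have L: "ori c d v * ori c d a < 0" using X by (simp add: crosses_def)
  have bary: "ori v a d * ori c d u + ori a u d * ori c d v + ori u v d * ori c d a = 0"
    using ori_barycentric[of u v a c d d] by simp
  show False
  proof (cases "ori c d u > 0")
    case True
    have 1: "ori v a d * ori c d u > 0" using True d by simp
    have "ori u v d < 0 \<Longrightarrow> ori c d v > 0 \<and> ori c d a < 0" "ori a u d < 0 \<Longrightarrow> ori c d a > 0 \<and> ori c d v < 0"
      using A' B' L True by (auto simp: mult_less_0_iff zero_le_mult_iff)
    hence "ori a u d * ori c d v > 0 \<and> ori u v d * ori c d a > 0"
      using out nz by (smt (verit) mult_pos_pos mult_neg_neg)
    thus False using bary 1 by linarith
  next
    case False
    hence F: "ori c d u < 0" using nz by simp
    hence 1: "ori v a d * ori c d u < 0" using d by (simp add: mult_pos_neg)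
    have "ori u v d < 0 \<Longrightarrow> ori c d v < 0 \<and> ori c d a > 0" "ori a u d < 0 \<Longrightarrow> ori c d a < 0 \<and> ori c d v > 0"
      using A' B' L F by (auto simp: mult_less_0_iff zero_le_mult_iff)
    hence "ori a u d * ori c d v < 0 \<and> ori u v d * ori c d a < 0"
      using out nz by (smt (verit) mult_pos_neg mult_neg_pos)
    thus False using bary 1 by linarith
  qed
qed

text \<open>An edge crossing \<open>v a\<close> either starts at \<open>u\<close>, and then runs
  strictly between \<open>v\<close> and \<open>a\<close>, or has an end inside the triangle. The
  first contradicts \<open>corner\<close>, the second \<open>corner_empty\<close>; maximality does
  the rest.\<close>

lemma corner_third_edge:
  assumes C: "corner u v a"
  shows "{v, a} \<in> T"
proof (rule maximal)
  have uv: "{u, v} \<in> T" and ua: "{u, a} \<in> T" and uva: "ori u v a > 0"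
    and no: "\<And>w. {u, w} \<in> T \<Longrightarrow> \<not> (ori u v w > 0 \<and> ori u w a > 0)"
    using C by (auto simp: corner_def)
  show vP: "v \<in> P" and aP: "a \<in> P" using edgeD[OF uv] edgeD[OF ua] by auto
  have uP: "u \<in> P" using edgeD[OF uv] by simp
  show "v \<noteq> a" using uva by auto
  have from_u: False if "{u, w} \<in> T" "crosses v a u w" for w
  proof -
    have w: "ori v a u * ori v a w < 0" "ori u w v * ori u w a < 0" using that by (auto simp: crosses_def)
    have 1: "ori v a w < 0" using w(1) uva by (simp add: ori_rotate[of u v a] mult_less_0_iff)
    show False
    proof (cases "ori u w v < 0")
      case True
      thus False using no[OF that(1)] w(2) by (auto simp: ori_swap[of u v w] mult_less_0_iff)
    next
      case False
      hence "ori u w v > 0" "ori u w a < 0" using w(2) by (auto simp: mult_less_0_iff)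
      moreover have "ori v a w = - ori u w a + ori u w v + ori u v a"
        by (simp add: ori_def algebra_simps)
      ultimately show False using 1 uva by simp
    qed
  qed
  have main: False if cd: "{c, d} \<in> T" and X: "crosses v a c d" and d: "ori v a d > 0" for c d
  proof (cases "u = c \<or> u = d")
    case True
    thus False using from_u[of d] from_u[of c] cd X edge_sym crosses_swap2 by blast
  next
    case False
    hence "ori u v d > 0 \<and> ori a u d > 0"
      using segment_ends_in_triangle[OF uP vP aP edgeD(1,2)[OF cd] uva _ _ X d] no_cross uv ua cd by blast
    thus False using corner_empty[OF C edgeD(2)[OF cd]] d by blast
  qed
  fix c d assume cd: "{c, d} \<in> T"
  show "\<not> crosses v a c d"
  proof
    assume X: "crosses v a c d"
    hence "ori v a c > 0 \<or> ori v a d > 0" by (auto simp: crosses_def mult_less_0_iff)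
    thus False using main[OF cd X] main[of d c] cd X edge_sym crosses_swap2 by blast
  qed
qed

text \<open>A neighbour of \<open>v\<close> strictly between \<open>a\<close> and \<open>u\<close>
  would lie inside the empty triangle or be reached by crossing the edge \<open>a u\<close>. The
  notion is therefore cyclic and describes a face, not just an angle at \<open>u\<close>.\<close>

lemma corner_rotate:
  assumes C: "corner u v a"
  shows "corner v a u"
  unfolding corner_def
proof (intro conjI allI impI notI)
  have uv: "{u, v} \<in> T" and ua: "{u, a} \<in> T" and uva: "ori u v a > 0"
    using C by (auto simp: corner_def)
  show "{v, a} \<in> T" by (rule corner_third_edge[OF C])
  show "{v, u} \<in> T" using uv by (rule edge_sym)
  show "ori v a u > 0" using uva by (simp add: ori_rotate[of u v a])
  fix w assume vw: "{v, w} \<in> T" and w: "ori v a w > 0 \<and> ori v w u > 0"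
  have 1: "ori u v w > 0" using w by (simp add: ori_rotate[of u v w])
  have "\<not> ori a u w > 0" using corner_empty[OF C edgeD(2)[OF vw]] w 1 by blast
  moreover have "ori a u w \<noteq> 0"
    using w 1 edgeD[OF ua] edgeD[OF vw] by (intro ori_neq_0) auto
  ultimately have "ori a u w < 0" by simp
  moreover have "ori a u v > 0" using uva by (simp add: ori_rotate[of a u v])
  moreover have "ori v w a < 0" using w by (simp add: ori_swap[of v w a])
  ultimately have "crosses v w a u" using w by (simp add: crosses_def mult_neg_pos mult_pos_neg)
  thus False using no_cross[OF vw edge_sym[OF ua]] by blast
qed

text \<open>The faces at \<open>{u, v}\<close> form a quadrilateral \<open>u\<close>,
  \<open>b\<close>, \<open>v\<close>, \<open>a\<close>, convex at \<open>u\<close> and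
  \<open>v\<close> by hypothesis. An edge from \<open>u\<close> or \<open>v\<close> across the
  diagonal \<open>a b\<close> can only be \<open>{u, v}\<close>, by the corner property. Any other
  edge across it would end inside the quadrilateral, hence in one of the two empty faces.\<close>

lemma flip_crosses_only:
  assumes C1: "corner u v a" and C2: "corner v u b" and cu: "ori u b a > 0" and cv: "ori v a b > 0"
    and cd: "{c, d} \<in> T" and X: "crosses a b c d"
  shows "{c, d} = {u, v}"
proof -
  have at_u: "w = v" if C1: "corner u v a" and C2: "corner v u b" and cu: "ori u b a > 0" 
    and uw: "{u, w} \<in> T" and X: "crosses a b u w" for u v a b w
  proof (rule ccontr)
    assume ne: "w \<noteq> v"
    have C2': "corner u b v" using C2 by (rule corner_rotate)
    have uv: "{u, v} \<in> T" using C1 by (simp add: corner_def)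
    have X': "ori a b u * ori a b w < 0" "ori u w a * ori u w b < 0" using X by (auto simp: crosses_def)
    have "ori a b u = - ori u b a" by (simp add: ori_def algebra_simps)
    hence "ori a b u < 0" using cu by simp
    hence abw: "ori a b w > 0" using X'(1) by (simp add: mult_less_0_iff)
    have "ori u v w \<noteq> 0" using ne edgeD[OF uv] edgeD[OF uw] by (intro ori_neq_0) auto
    moreover have "ori u w a > 0 \<and> ori u w b < 0"
    proof (rule ccontr)
      assume "\<not> ?thesis"
      hence "ori u w a < 0" "ori u w b > 0" using X'(2) by (auto simp: mult_less_0_iff)
      moreover have "ori a b w = ori u w a - ori u w b - ori u b a"
        by (simp add: ori_def algebra_simps)
      ultimately show False using abw cu by simp
    qed
    ultimately show False
      using C1 C2' uw unfolding corner_def ori_swap[of u w v] ori_swap[of u b w]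
      by (smt (verit) ori_swap)
  qed
  have C1': "corner v a u" and C2': "corner u b v" using C1 C2 corner_rotate by auto
  have E: "{u, v} \<in> T" "{v, a} \<in> T" "{u, a} \<in> T" "{u, b} \<in> T" "{v, b} \<in> T"
    using C1 C2 C1' C2' by (auto simp: corner_def)
  have uP: "u \<in> P" "v \<in> P" "a \<in> P" "b \<in> P" using E edgeD by blast+
  have main: False if cd: "{c, d} \<in> T" and X: "crosses a b c d" and d: "ori a b d > 0"
    and ne: "u \<noteq> c" "u \<noteq> d" "v \<noteq> c" "v \<noteq> d" for c d
  proof -
    have dP: "c \<in> P" "d \<in> P" using edgeD[OF cd] by auto
    have nX: "\<not> crosses v a c d" "\<not> crosses v b c d" using no_cross E cd by blast+
    have vd: "ori v a d > 0" "ori b v d > 0"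
      \<comment> \<open>The triangle is \<open>v\<close>, \<open>a\<close>, \<open>b\<close> with
        apex \<open>v\<close>; the diagonal plays the part of the crossed side.\<close>
      using segment_ends_in_triangle[OF uP(2,3,4) dP cv ne(3,4) X d nX] by auto
    have "ori v a b * ori a u d > 0" "ori v a b * ori u b d > 0"
    proof -
      have "ori v a b * ori a u d = ori a b d * ori a u v + ori v a d * ori a u b"
        using ori_barycentric[of v a b a u d] by simp
      also have "\<dots> > 0" using d vd cu C1
        by (intro add_pos_pos mult_pos_pos) (auto simp: ori_rotate[of a u] corner_def)
      finally show "ori v a b * ori a u d > 0" .
      have "ori v a b * ori u b d = ori a b d * ori u b v + ori b v d * ori u b a"
        using ori_barycentric[of v a b u b d] by simp
      also have "\<dots> > 0" using d vd cu C2' by (intro add_pos_pos mult_pos_pos) (auto simp: corner_def)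
      finally show "ori v a b * ori u b d > 0" .
    qed
    hence ud: "ori a u d > 0" "ori u b d > 0" using cv by (auto simp: zero_less_mult_iff)
    have "ori u v d \<noteq> 0" using uP dP ne edgeD(3)[OF E(1)] by (intro ori_neq_0) auto
    hence "ori u v d > 0 \<or> ori v u d > 0" by (auto simp: ori_flip[of u v])
    thus False
      using corner_empty[OF C1 dP(2)] corner_empty[OF C2 dP(2)] ud vd by blast
  qed
  show ?thesis
  proof (cases "u \<in> {c, d} \<or> v \<in> {c, d}")
    case True
    moreover have "w = v" if "{u, w} \<in> T" "crosses a b u w" for w
      using at_u[OF C1 C2 cu that] .
    moreover have "w = u" if "{v, w} \<in> T" "crosses a b v w" for w
      using at_u[OF C2 C1 cv that(1)] that(2) by (simp add: crosses_swap)
    ultimately show ?thesis using cd X edge_sym crosses_swap2 by (metis doubleton_eq_iff empty_iff insert_iff)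
  next
    case False
    have "ori a b c > 0 \<or> ori a b d > 0" using X by (auto simp: crosses_def mult_less_0_iff)
    thus ?thesis using main[OF cd X] main[of d c] cd X False edge_sym crosses_swap2 by blast
  qed
qed

end

subsection \<open>Unflippable edges\<close>

lemma plane_on_insert:
  assumes A: "plane_on P A" and ab: "a \<in> P" "b \<in> P" "a \<noteq> b"
    and nX: "\<And>c d. {c, d} \<in> A \<Longrightarrow> \<not> crosses a b c d"
  shows "plane_on P (insert {a, b} A)"
  unfolding plane_on_def
proof (intro conjI allI impI)
  show "insert {a, b} A \<subseteq> edges_on P"
    using A ab by (auto simp: plane_on_def edges_on_pair)
  have self: "\<not> crosses x y z w" if "{x, y} = {a, b}" "{z, w} = {a, b}" for x y z w
    using that by (auto simp: doubleton_eq_iff crosses_def)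
  have one: "\<not> crosses x y z w" if "{x, y} = {a, b}" "{z, w} \<in> A" for x y z w
    using that nX[of z w] by (auto simp: doubleton_eq_iff crosses_swap)
  fix x y z w assume "{x, y} \<in> insert {a, b} A" "{z, w} \<in> insert {a, b} A"
  thus "\<not> crosses x y z w"
    using self one[of x y z w] one[of z w x y] A
    by (auto simp: plane_on_def crosses_commute[of x y z w])
qed

lemma plane_on_mono: "plane_on P A \<Longrightarrow> B \<subseteq> A \<Longrightarrow> plane_on P B"
  unfolding plane_on_def by blast

lemma triangulation_exists:
  assumes gp: "gen_pos P" and A: "plane_on P A"
  obtains T where "A \<subseteq> T" "triangulation P T"
proof -
  define S where "S = {B. plane_on P B \<and> A \<subseteq> B}"
  have "finite P" using gp by (simp add: gen_pos_def)
  hence "finite (Pow (edges_on P))" by (simp add: finite_edges_on)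
  moreover have "S \<subseteq> Pow (edges_on P)" by (auto simp: S_def plane_on_def)
  ultimately have "finite S" by (rule rev_finite_subset)
  moreover have "A \<in> S" using A by (simp add: S_def)
  ultimately obtain T where T: "T \<in> S" and max: "\<And>B. B \<in> S \<Longrightarrow> T \<subseteq> B \<Longrightarrow> T = B"
    using finite_has_maximal[of S] by blast
  have "\<exists>c d. {c, d} \<in> T \<and> crosses a b c d" if "a \<in> P" "b \<in> P" "a \<noteq> b" "{a, b} \<notin> T" for a b
  proof (rule ccontr)
    assume "\<not> ?thesis"
    hence "plane_on P (insert {a, b} T)"
      using T that by (intro plane_on_insert) (auto simp: S_def)
    hence "insert {a, b} T \<in> S" using T by (auto simp: S_def)
    hence "T = insert {a, b} T" by (rule max) auto
    thus False using that(4) by blast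
  qed
  hence "triangulation P T" using gp T by (simp add: triangulation_def S_def)
  thus ?thesis using that T unfolding S_def by blast
qed

text \<open>\<open>d\<close> is an outer normal of a supporting line through \<open>v\<close>. In
  general position such points are exactly the vertices of the convex hull, even when the line
  contains a second point.\<close>

definition hull_vertices :: "(real^2) set \<Rightarrow> (real^2) set" where
  "hull_vertices P = {v \<in> P. \<exists>d. d \<noteq> 0 \<and> (\<forall>w\<in>P. d \<bullet> (w - v) \<le> 0)}"

lemma inner_perp_expand:
  "(x \<bullet> w) * (e \<bullet> e) = (x \<bullet> e) * (e \<bullet> w) + (x \<bullet> perp e) * (perp e \<bullet> w)"
  by (simp add: perp_def inner_vec_def sum_2 algebra_simps)

lemma perp_inner_perp: "perp x \<bullet> perp y = x \<bullet> y"
  by (simp add: perp_def inner_vec_def sum_2)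

lemma perp_uminus: "perp (- x) = - perp x"
  by (simp add: perp_def vec_eq_iff forall_2)

text \<open>Among the directions \<open>(1, t)\<close>, each pair of points rules out at most one
  \<open>t\<close>.\<close>

lemma separating_direction:
  assumes "finite P"
  obtains e :: "real^2" where "e \<noteq> 0" "\<And>a b. a \<in> P \<Longrightarrow> b \<in> P \<Longrightarrow> a \<noteq> b \<Longrightarrow> e \<bullet> (a - b) \<noteq> 0"
proof -
  define bad where "bad = (\<lambda>(a, b). - (a$1 - b$1) / (a$2 - b$2)) ` (P \<times> P)"
  have "finite bad" using assms by (simp add: bad_def)
  then obtain t where t: "t \<notin> bad" using ex_new_if_finite[OF infinite_UNIV_char_0] by blast
  define e :: "real^2" where "e = vector [1, t]"
  show ?thesis
  proof (rule that[of e])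
    show "e \<noteq> 0" by (simp add: e_def vec_eq_iff forall_2)
    fix a b assume ab: "a \<in> P" "b \<in> P" "a \<noteq> b"
    have eq: "e \<bullet> (a - b) = (a$1 - b$1) + t * (a$2 - b$2)"
      by (simp add: e_def inner_vec_def sum_2)
    show "e \<bullet> (a - b) \<noteq> 0"
    proof
      assume 0: "e \<bullet> (a - b) = 0"
      show False
      proof (cases "a$2 = b$2")
        case True
        thus False using 0 eq ab(3) by (simp add: vec_eq_iff forall_2)
      next
        case False
        have "t * (a$2 - b$2) = - (a$1 - b$1)" using 0 eq by simp
        hence "t = - (a$1 - b$1) / (a$2 - b$2)" using False by (simp add: eq_divide_eq)
        hence "t \<in> bad" using ab(1,2) by (force simp: bad_def)
        thus False using t by blast
      qed
    qed
  qed
qed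

context triang begin

text \<open>Without this edge, \<open>u\<close> would see an angle of at least a straight one free
  of edges. This is the local obstruction to flipping.\<close>

definition essential :: "real^2 \<Rightarrow> real^2 \<Rightarrow> bool" where
  "essential u v \<longleftrightarrow> {u, v} \<in> T \<and>
     (\<exists>d. d \<bullet> (v - u) > 0 \<and> (\<forall>w. {u, w} \<in> T \<longrightarrow> w \<noteq> v \<longrightarrow> d \<bullet> (w - u) \<le> 0))"

text \<open>The vectors to \<open>a\<close>, \<open>b\<close>, \<open>c\<close> satisfy a linear
  relation whose coefficients are the three turns. If the first two turns disagreed, one
  coefficient, that of \<open>a\<close> or of \<open>b\<close>, would differ in sign from both
  others. The half-plane witness of that neighbour would then make the relation nonzero.\<close>

lemma essential_same_turn:
  assumes E: "essential u a" "essential u b" "essential u c"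
    and ne: "a \<noteq> b" "a \<noteq> c" "b \<noteq> c"
  shows "ori u b c * ori u c a > 0"
proof (rule ccontr)
  assume neg: "\<not> ?thesis"
  have T: "{u, a} \<in> T" "{u, b} \<in> T" "{u, c} \<in> T" using E by (auto simp: essential_def)
  have nz: "ori u b c \<noteq> 0" "ori u c a \<noteq> 0" "ori u a b \<noteq> 0"
    using ori_neq_0 edgeD[OF T(1)] edgeD[OF T(2)] edgeD[OF T(3)] ne by auto
  have rel: "ori u b c * (d \<bullet> (a - u)) + ori u c a * (d \<bullet> (b - u)) + ori u a b * (d \<bullet> (c - u)) = 0" for d
    by (simp add: ori_def inner_vec_def sum_2 algebra_simps)
  obtain da where da: "da \<bullet> (a - u) > 0" "da \<bullet> (b - u) \<le> 0" "da \<bullet> (c - u) \<le> 0"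
    using E(1) T ne unfolding essential_def by metis
  obtain db where db: "db \<bullet> (b - u) > 0" "db \<bullet> (a - u) \<le> 0" "db \<bullet> (c - u) \<le> 0"
    using E(2) T ne unfolding essential_def by metis
  have bad: False if "x * p + y * q + z * r = 0" "p > 0" "q \<le> 0" "r \<le> 0"
    "(x > 0 \<and> y < 0 \<and> z < 0) \<or> (x < 0 \<and> y > 0 \<and> z > 0)" for x y z p q r :: real
    using that mult_pos_pos[of x p] mult_neg_pos[of x p] mult_nonpos_nonpos[of y q] mult_nonpos_nonpos[of z r]
      mult_nonneg_nonpos[of y q] mult_nonneg_nonpos[of z r] by linarith
  have "(ori u b c > 0 \<and> ori u c a < 0) \<or> (ori u b c < 0 \<and> ori u c a > 0)"
    using neg nz by (auto simp: zero_less_mult_iff not_less)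
  moreover have "\<not> ((ori u b c > 0 \<and> ori u c a < 0 \<and> ori u a b < 0) \<or> (ori u b c < 0 \<and> ori u c a > 0 \<and> ori u a b > 0))"
    using bad[OF rel[of da] da] by blast
  moreover have "ori u c a * (db \<bullet> (b - u)) + ori u b c * (db \<bullet> (a - u)) + ori u a b * (db \<bullet> (c - u)) = 0"
    using rel[of db] by simp
  hence "\<not> ((ori u c a > 0 \<and> ori u b c < 0 \<and> ori u a b < 0) \<or> (ori u c a < 0 \<and> ori u b c > 0 \<and> ori u a b > 0))"
    using bad[OF _ db] by blast
  ultimately show False using nz(3) by linarith
qed

lemma finite_essential: "finite {v. essential u v}"
  using finite_nbrs[of u] by (rule finite_subset[rotated]) (auto simp: essential_def)

text \<open>With four neighbours, the triples \<open>a b c\<close> and \<open>a b d\<close> give the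
  turns from \<open>c\<close> to \<open>a\<close> and from \<open>d\<close> to \<open>a\<close> the
  sign of the turn from \<open>a\<close> to \<open>b\<close>. The triple \<open>c d a\<close> gives
  the turn from \<open>a\<close> to \<open>c\<close> that sign as well, but it is the negative of
  the turn from \<open>c\<close> to \<open>a\<close>.\<close>

lemma card_essential_le: "card {v. essential u v} \<le> 3"
proof (rule ccontr)
  assume "\<not> ?thesis"
  hence "4 \<le> card {v. essential u v}" by simp
  then obtain S where S: "S \<subseteq> {v. essential u v}" "card S = 4"
    by (rule obtain_subset_with_card_n) blast
  then obtain a b c d where dist: "distinct [a, b, c, d]" and "S = {a, b, c, d}"
    by (auto simp: card_Suc_eq numeral_eq_Suc)
  hence E: "essential u a" "essential u b" "essential u c" "essential u d" using S by auto
  have "ori u b c * ori u c a > 0" "ori u c a * ori u a b > 0"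
    using essential_same_turn[of u a b c] essential_same_turn[of u b c a] E dist by auto
  moreover have "ori u b d * ori u d a > 0" "ori u d a * ori u a b > 0"
    using essential_same_turn[of u a b d] essential_same_turn[of u b d a] E dist by auto
  moreover have "ori u d a * ori u a c > 0"
    using essential_same_turn[of u c d a] E dist by auto
  ultimately show False
    by (auto simp: ori_swap[of u a c] zero_less_mult_iff mult_less_0_iff)
qed

text \<open>If the two faces at \<open>{u, v}\<close> together have a reflex angle at
  \<open>u\<close>, all other neighbours lie in the remaining angle from \<open>a\<close> to
  \<open>b\<close>, which is less than straight. Moreover \<open>v\<close>, \<open>a\<close>,
  \<open>b\<close> surround \<open>u\<close>, so no supporting line passes through it.\<close>

lemma reflex_imp_essential:
  assumes C1: "corner u v a" and C2: "corner v u b" and reflex: "ori u a b > 0"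
  shows "essential u v" and "u \<notin> hull_vertices P"
proof -
  have C2': "corner u b v" using C2 by (rule corner_rotate)
  have T: "{u, v} \<in> T" "{u, a} \<in> T" "{u, b} \<in> T" using C1 C2' by (auto simp: corner_def)
  have o: "ori u v a > 0" "ori u b v > 0" using C1 C2' by (auto simp: corner_def)
  have rel: "ori u a b * (d \<bullet> (v - u)) + ori u b v * (d \<bullet> (a - u)) + ori u v a * (d \<bullet> (b - u)) = 0" for d
    by (simp add: ori_def inner_vec_def sum_2 algebra_simps)
  have sum3: "x = 0 \<and> y = 0 \<and> z = 0"
    if "p * x + q * y + r * z = 0" "p > 0" "q > 0" "r > 0" "x \<le> 0" "y \<le> 0" "z \<le> 0" for x y z p q r :: real
  proof -
    have "p * x \<le> 0" "q * y \<le> 0" "r * z \<le> 0" using that by (auto simp: mult_le_0_iff)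
    hence "p * x = 0" "q * y = 0" "r * z = 0" using that(1) by linarith+
    thus ?thesis using that by auto
  qed
  \<comment> \<open>\<open>v\<close>, \<open>a\<close>, \<open>b\<close> positively span the plane,
    so no line through \<open>u\<close> has all three strictly on one side.\<close>
  have not_left: False if "ori u w v > 0" "ori u w a > 0" "ori u w b > 0" for w
    using sum3[OF rel[of "- perp (w - u)"] reflex o(2,1)] that by (auto simp: perp_inner)
  have not_right: False if "ori u v w > 0" "ori u a w > 0" "ori u b w > 0" for w
    using sum3[OF rel[of "perp (w - u)"] reflex o(2,1)] that
    by (auto simp: perp_inner ori_swap[of u w])
  have nbr: "ori u a w \<ge> 0 \<and> ori u w b \<ge> 0" if w: "{u, w} \<in> T" "w \<noteq> v" for w
  proof -
    have wv: "ori u v w \<noteq> 0" using edgeD[OF w(1)] edgeD[OF T(1)] w by (intro ori_neq_0) auto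
    have 1: "\<not> (ori u v w > 0 \<and> ori u w a > 0)" and 2: "\<not> (ori u b w > 0 \<and> ori u w v > 0)"
      using C1 C2' w(1) by (auto simp: corner_def)
    have eq: "ori u w a = - ori u a w" "ori u w v = - ori u v w" "ori u b w = - ori u w b"
      by (rule ori_swap)+
    have "ori u a w \<ge> 0"
    proof (rule ccontr)
      assume "\<not> ?thesis"
      hence aw: "ori u w a > 0" using eq by simp
      hence vw: "ori u w v > 0" using 1 wv eq by linarith
      have "w \<noteq> b" using aw reflex eq(1) by auto
      hence "ori u w b \<noteq> 0" using edgeD[OF w(1)] edgeD[OF T(3)] by (intro ori_neq_0) auto
      hence "ori u w b > 0" using 2 vw eq by linarith
      thus False using not_left aw vw by blast
    qed
    moreover have "ori u w b \<ge> 0"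
    proof (rule ccontr)
      assume "\<not> ?thesis"
      hence bw: "ori u b w > 0" using eq by simp
      hence vw: "ori u v w > 0" using 2 wv eq by linarith
      have "w \<noteq> a" using bw reflex by (auto simp: ori_swap[of u b a])
      hence "ori u a w \<noteq> 0" using edgeD[OF w(1)] edgeD[OF T(2)] by (intro ori_neq_0) auto
      hence "ori u a w > 0" using 1 vw eq by linarith
      thus False using not_right bw vw by blast
    qed
    ultimately show ?thesis by blast
  qed
  \<comment> \<open>Each of the two rotated vectors contributes a nonpositive term on the angle from
    \<open>a\<close> to \<open>b\<close> and a positive one at \<open>v\<close>.\<close>
  define d where "d = perp (b - u) - perp (a - u)"
  have d: "d \<bullet> (w - u) = - ori u w b - ori u a w" for w
    by (simp add: d_def inner_diff_left perp_inner ori_swap[of u b w])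
  have "d \<bullet> (v - u) > 0"
    using o unfolding d by (simp add: ori_swap[of u v b] ori_swap[of u a v])
  moreover have "d \<bullet> (w - u) \<le> 0" if "{u, w} \<in> T" "w \<noteq> v" for w
    using nbr[OF that] unfolding d by simp
  ultimately show "essential u v" using T(1) by (auto simp: essential_def)
  show "u \<notin> hull_vertices P"
  proof
    assume "u \<in> hull_vertices P"
    then obtain d where d: "d \<noteq> 0" "\<And>w. w \<in> P \<Longrightarrow> d \<bullet> (w - u) \<le> 0"
      by (auto simp: hull_vertices_def)
    \<comment> \<open>A functional that is nonpositive on three vectors with a positive linear
      relation vanishes on all of them.\<close>
    have 0: "d \<bullet> (v - u) = 0" "d \<bullet> (a - u) = 0"
      using sum3[OF rel[of d] reflex o(2,1)] d(2) edgeD[OF T(1)] edgeD[OF T(2)] edgeD[OF T(3)] by auto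
    have "ori u v a * (d \<bullet> d) = 0" using ori_perp[of u v a d] 0 by simp
    thus False using o d(1) by simp
  qed
qed

text \<open>With points on both sides there is a face on each side. The quadrilateral they form is
  reflex at \<open>u\<close>, reflex at \<open>v\<close>, or convex at both; in the last case the
  diagonal can be exchanged.\<close>

lemma flippable_or_essential:
  assumes uv: "{u, v} \<in> T" and q: "q \<in> P" "ori u v q > 0" and q': "q' \<in> P" "ori v u q' > 0"
  obtains a b where "a \<in> P" "b \<in> P" "a \<noteq> b" "crosses a b u v" "plane_on P (insert {a, b} (T - {{u, v}}))"
  | "essential u v" "u \<notin> hull_vertices P"
  | "essential v u" "v \<notin> hull_vertices P"
proof -
  obtain a where C1: "corner u v a" using corner_exists[OF uv q] by blast
  obtain b where C2: "corner v u b" using corner_exists[OF edge_sym[OF uv] q'] by blast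
  have o: "ori u v a > 0" "ori v u b > 0" and T: "{u, a} \<in> T" "{v, b} \<in> T"
    using C1 C2 by (auto simp: corner_def)
  have P: "u \<in> P" "v \<in> P" "a \<in> P" "b \<in> P" using edgeD[OF uv] edgeD[OF T(1)] edgeD[OF T(2)] by auto
  have ab: "a \<noteq> b" using o by (auto simp: ori_flip[of u v])
  have ne: "u \<noteq> a" "u \<noteq> b" "v \<noteq> a" "v \<noteq> b" using o by auto
  have nz: "ori u b a \<noteq> 0" "ori v a b \<noteq> 0" using ori_neq_0 P ab ne by auto
  have "ori u a b > 0 \<or> ori v b a > 0 \<or> ori u b a > 0 \<and> ori v a b > 0"
    using nz ori_swap[of u a b] ori_swap[of v b a] by linarith
  then consider "ori u a b > 0" | "ori v b a > 0" | "ori u b a > 0" "ori v a b > 0"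
    by blast
  thus ?thesis
  proof cases
    case 1
    thus ?thesis using reflex_imp_essential[OF C1 C2] that(2) by blast
  next
    case 2
    thus ?thesis using reflex_imp_essential[OF C2 C1] that(3) by blast
  next
    case 3
    have "plane_on P (insert {a, b} (T - {{u, v}}))"
    proof (rule plane_on_insert)
      show "plane_on P (T - {{u, v}})"
        using triang by (auto simp: triangulation_def intro: plane_on_mono)
      show "\<not> crosses a b c d" if "{c, d} \<in> T - {{u, v}}" for c d
        using flip_crosses_only[OF C1 C2 3, of c d] that by blast
    qed (use P ab in auto)
    moreover have "ori a b u = - ori u b a" "ori a b v = ori v a b" "ori u v b = - ori v u b"
      by (simp_all add: ori_def algebra_simps)
    hence "crosses a b u v" using 3 o by (simp add: crosses_def mult_pos_neg mult_neg_pos)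
    ultimately show ?thesis using that(1) P ab by blast
  qed
qed

text \<open>The hull edges, directed clockwise.\<close>

definition left_empty :: "((real^2) \<times> (real^2)) set" where
  "left_empty = {(u, v). {u, v} \<in> T \<and> (\<forall>w\<in>P. ori u v w \<le> 0)}"

lemma finite_left_empty: "finite left_empty"
  by (rule finite_subset[of _ "P \<times> P"]) (use finite_P in \<open>auto simp: left_empty_def dest: edgeD\<close>)

text \<open>An edge with an empty side is charged to \<open>left_empty\<close> in one of its
  directions. Any other one is essential at an end off the hull, and each such end carries at most
  three.\<close>

lemma card_unflippable_le:
  assumes S: "S \<subseteq> T"
    and unflip: "\<And>a b u v. \<lbrakk>{u, v} \<in> S; a \<in> P; b \<in> P; a \<noteq> b; crosses a b u v\<rbrakk>
                  \<Longrightarrow> \<not> plane_on P (insert {a, b} (T - {{u, v}}))"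
  shows "card S \<le> card left_empty + 3 * card (P - hull_vertices P)"
proof -
  define I where "I = P - hull_vertices P"
  define K where "K = (\<lambda>(u, v). {u, v}) ` left_empty"
  define Z where "Z = (\<Union>u\<in>I. (\<lambda>v. {u, v}) ` {v. essential u v})"
  have finI: "finite I" using finite_P by (simp add: I_def)
  have finZ: "finite Z" using finI finite_essential by (auto simp: Z_def)
  have finK: "finite K" using finite_left_empty by (simp add: K_def)
  have "S \<subseteq> K \<union> Z"
  proof
    fix e assume eS: "e \<in> S"
    hence "e \<in> edges_on P" using S triang by (auto simp: triangulation_def plane_on_def)
    then obtain u v where e: "e = {u, v}" and "u \<in> P" "v \<in> P" by (auto simp: edges_on_def)
    have uv: "{u, v} \<in> T" "{v, u} \<in> T" using eS S e by (auto simp: insert_commute)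
    show "e \<in> K \<union> Z"
    proof (cases "(u, v) \<in> left_empty \<or> (v, u) \<in> left_empty")
      case True
      thus ?thesis unfolding K_def e by (force simp: insert_commute)
    next
      case False
      then obtain q q' where q: "q \<in> P" "ori u v q > 0" and q': "q' \<in> P" "ori v u q' > 0"
        using uv by (auto simp: left_empty_def not_le)
      show ?thesis
      proof (rule flippable_or_essential[OF uv(1) q q'])
        fix a b assume "a \<in> P" "b \<in> P" "a \<noteq> b" "crosses a b u v" "plane_on P (insert {a, b} (T - {{u, v}}))"
        thus ?thesis using unflip eS e by blast
      next
        assume "essential u v" "u \<notin> hull_vertices P"
        hence "e \<in> Z" unfolding Z_def I_def e using \<open>u \<in> P\<close> by blast
        thus ?thesis by blast
      next
        assume "essential v u" "v \<notin> hull_vertices P"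
        hence "e \<in> Z" unfolding Z_def I_def e using \<open>v \<in> P\<close> by (auto simp: insert_commute)
        thus ?thesis by blast
      qed
    qed
  qed
  hence "card S \<le> card (K \<union> Z)" using finK finZ by (intro card_mono) auto
  also have "\<dots> \<le> card K + card Z" by (rule card_Un_le)
  also have "card K \<le> card left_empty" unfolding K_def by (rule card_image_le[OF finite_left_empty])
  also have "card Z \<le> (\<Sum>u\<in>I. card ((\<lambda>v. {u, v}) ` {v. essential u v}))"
    unfolding Z_def by (rule card_UN_le[OF finI])
  also have "\<dots> \<le> (\<Sum>u\<in>I. 3)"
    by (rule sum_mono) (rule order_trans[OF card_image_le[OF finite_essential] card_essential_le])
  also have "\<dots> = 3 * card I" by simp
  finally show ?thesis by (simp add: I_def)
qed

subsection \<open>A lower bound on the number of edges\<close>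

text \<open>Think of \<open>e\<close> as pointing right and \<open>perp e\<close> as pointing up.
  Let \<open>b\<close> be the most counterclockwise neighbour on the right and \<open>a\<close> the
  most clockwise on the left. If the angle from \<open>b\<close> to \<open>a\<close> is less than
  straight, they bound the triangle directly above \<open>v\<close>. Otherwise all neighbours lie
  below a line through \<open>v\<close>, and then so does \<open>P\<close>. The strict inequalities
  at \<open>a\<close> and \<open>b\<close> are what later excludes supports from above and below at
  once.\<close>

lemma upper_corner_or_support:
  assumes v: "v \<in> P" and sep: "\<And>w. w \<in> P \<Longrightarrow> w \<noteq> v \<Longrightarrow> e \<bullet> (w - v) \<noteq> 0"
    and x: "x \<in> P" "e \<bullet> (x - v) > 0" and y: "y \<in> P" "e \<bullet> (y - v) < 0"
  shows "(\<exists>b a. corner v b a \<and> e \<bullet> (b - v) > 0 \<and> e \<bullet> (a - v) < 0) \<or>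
    (\<exists>d a b. d \<bullet> perp e > 0 \<and> (\<forall>w\<in>P. d \<bullet> (w - v) \<le> 0) \<and> a \<in> P \<and> b \<in> P \<and>
       e \<bullet> (a - v) < 0 \<and> d \<bullet> (a - v) < 0 \<and> e \<bullet> (b - v) > 0 \<and> d \<bullet> (b - v) < 0)"
proof -
  define R where "R = {w. {v, w} \<in> T \<and> e \<bullet> (w - v) > 0}"
  define L where "L = {w. {v, w} \<in> T \<and> (- e) \<bullet> (w - v) > 0}"
  have fin: "finite R" "finite L" using finite_nbrs[of v] by (auto simp: R_def L_def intro: finite_subset)
  have pos: "w \<in> R \<Longrightarrow> e \<bullet> (w - v) > 0" "w \<in> L \<Longrightarrow> (- e) \<bullet> (w - v) > 0" for w
    by (simp_all add: R_def L_def)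
  have "R \<noteq> {}" using halfplane_neighbour[OF v x] by (auto simp: R_def)
  then obtain b where b: "b \<in> R" and bmax: "\<And>w. w \<in> R \<Longrightarrow> ori v b w \<le> 0"
    using extreme_angle(2)[OF fin(1) _ pos(1)] by blast
  have "L \<noteq> {}" using halfplane_neighbour[OF v y(1), of "- e"] y(2) by (auto simp: L_def)
  then obtain a where a: "a \<in> L" and amin: "\<And>w. w \<in> L \<Longrightarrow> ori v w a \<le> 0"
    using extreme_angle(1)[OF fin(2) _ pos(2)] by blast
  have Tab: "{v, a} \<in> T" "{v, b} \<in> T" and ea: "e \<bullet> (a - v) < 0" and eb: "e \<bullet> (b - v) > 0"
    using a b by (auto simp: R_def L_def)
  have P: "a \<in> P" "b \<in> P" "v \<noteq> a" "v \<noteq> b" using edgeD[OF Tab(1)] edgeD[OF Tab(2)] by auto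
  have "a \<noteq> b" using ea eb by auto
  hence "ori v b a \<noteq> 0" using ori_neq_0 v P by auto
  have LR: "w \<in> L \<or> w \<in> R" if "{v, w} \<in> T" for w
    using sep[of w] edgeD[OF that] that by (auto simp: L_def R_def linorder_neq_iff)
  show ?thesis
  proof (cases "ori v b a > 0")
    case True
    have "corner v b a"
      using Tab True LR bmax amin unfolding corner_def by (meson not_le)
    thus ?thesis using ea eb by blast
  next
    case False
    hence ab: "ori v a b > 0" using \<open>ori v b a \<noteq> 0\<close> by (simp add: ori_swap[of v a b])
    define d where "d = perp (b - v) - perp (a - v)"
    have d: "d \<bullet> (w - v) = ori v b w - ori v a w" for w
      by (simp add: d_def inner_diff_left perp_inner)
    have rel: "ori v a b * (e \<bullet> (w - v)) = - ori v b w * (e \<bullet> (a - v)) + ori v a w * (e \<bullet> (b - v))" for w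
      using ori_inner[of v a b e w] by (simp add: ori_swap[of v w b])
    have neg: "d \<bullet> (w - v) < 0" if w: "{v, w} \<in> T" for w
    proof (cases "w \<in> R")
      case True
      hence 1: "ori v b w \<le> 0" "e \<bullet> (w - v) > 0" using bmax by (auto simp: R_def)
      have "ori v a b * (e \<bullet> (w - v)) > 0" using ab 1 by simp
      moreover have "- ori v b w * (e \<bullet> (a - v)) \<le> 0" using 1 ea by (simp add: mult_nonneg_nonpos mult_nonpos_nonpos mult_le_0_iff)
      ultimately have "ori v a w * (e \<bullet> (b - v)) > 0" using rel[of w] by linarith
      hence "ori v a w > 0" using eb by (simp add: zero_less_mult_iff)
      thus ?thesis using 1 unfolding d by simp
    next
      case False
      hence wL: "w \<in> L" using LR[OF w] by blast
      hence "ori v w a \<le> 0" by (rule amin)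
      hence 1: "ori v a w \<ge> 0" "e \<bullet> (w - v) < 0" using wL by (auto simp: L_def ori_swap[of v w a])
      have "ori v a b * (e \<bullet> (w - v)) < 0" using ab 1 by (simp add: mult_pos_neg)
      moreover have "ori v a w * (e \<bullet> (b - v)) \<ge> 0" using 1 eb by simp
      ultimately have "- ori v b w * (e \<bullet> (a - v)) < 0" using rel[of w] by linarith
      hence "ori v b w < 0" using ea by (simp add: zero_less_mult_iff mult_less_0_iff)
      thus ?thesis using 1 unfolding d by simp
    qed
    \<comment> \<open>A point with a positive value would force a neighbour with a positive
      value.\<close>
    have "d \<bullet> (w - v) \<le> 0" if "w \<in> P" for w
      using halfplane_neighbour[OF v that, of d] neg by (meson not_le order_less_imp_le order_less_irrefl order_less_trans)
    moreover have "d \<bullet> perp e > 0"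
    proof -
      have "d \<bullet> perp e = e \<bullet> (b - v) - e \<bullet> (a - v)"
        unfolding d_def inner_diff_left perp_inner_perp by (simp add: inner_diff_left inner_commute[of e])
      thus ?thesis using ea eb by simp
    qed
    ultimately show ?thesis using neg[OF Tab(1)] neg[OF Tab(2)] ea eb P by blast
  qed
qed

text \<open>Each triangular face is listed three times, once for each first vertex.\<close>

definition corners :: "((real^2) \<times> (real^2) \<times> (real^2)) set" where
  "corners = {(p, q, r). corner p q r}"

lemma cornerD:
  assumes "corner p q r"
  shows "p \<in> P" "q \<in> P" "r \<in> P" "{p, q} \<in> T" "{p, r} \<in> T" "ori p q r > 0"
  using assms edgeD by (auto simp: corner_def)

lemma finite_corners: "finite corners"
  by (rule finite_subset[of _ "P \<times> P \<times> P"]) (use finite_P in \<open>auto simp: corners_def dest: cornerD\<close>)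

lemma card_directed_edges: "card {(u, v). {u, v} \<in> T} = 2 * card T"
proof -
  have fin: "finite {(u, v). {u, v} \<in> T}"
    by (rule finite_subset[of _ "P \<times> P"]) (use finite_P in \<open>auto dest: edgeD\<close>)
  have eq: "{(u, v). {u, v} \<in> T} = (\<Union>e\<in>T. {(u, v). {u, v} = e})" by auto
  have c: "finite {(u, v). {u, v} = e} \<and> card {(u, v). {u, v} = e} = 2" if e: "e \<in> T" for e
  proof -
    have "e \<in> edges_on P" using e triang by (auto simp: triangulation_def plane_on_def)
    then obtain a b where ab: "e = {a, b}" "a \<noteq> b" by (auto simp: edges_on_def)
    hence "{(u, v). {u, v} = e} = {(a, b), (b, a)}" by (auto simp: doubleton_eq_iff)
    thus ?thesis using ab by simp
  qed
  have "card {(u, v). {u, v} \<in> T} = (\<Sum>e\<in>T. card {(u, v). {u, v} = e})"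
    unfolding eq by (rule card_UN_disjoint[OF finite_T]) (use c in auto)
  also have "\<dots> = (\<Sum>e\<in>T. 2)" by (rule sum.cong) (use c in auto)
  finally show ?thesis by simp
qed

text \<open>A corner is determined by its first directed edge, and such an edge has a point on its
  left, so it is not in \<open>left_empty\<close>. Both kinds sit among the
  \<open>2 * card T\<close> directed edges.\<close>

lemma card_corners_le: "card corners + card left_empty \<le> 2 * card T"
proof -
  define D where "D = {(u, v). {u, v} \<in> T}"
  define h where "h = (\<lambda>(p :: real^2, q :: real^2, r :: real^2). (p, q))"
  have finD: "finite D" unfolding D_def
    by (rule finite_subset[of _ "P \<times> P"]) (use finite_P in \<open>auto dest: edgeD\<close>)
  have "inj_on h corners"
    by (auto simp: inj_on_def h_def corners_def dest: corner_unique)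
  hence "card corners = card (h ` corners)" by (simp add: card_image)
  also have "\<dots> + card left_empty = card (h ` corners \<union> left_empty)"
  proof (rule card_Un_disjoint[symmetric])
    show "h ` corners \<inter> left_empty = {}"
    proof (rule equals0I)
      fix x assume "x \<in> h ` corners \<inter> left_empty"
      then obtain p q r where "corner p q r" "(p, q) \<in> left_empty"
        by (auto simp: h_def corners_def)
      thus False using cornerD(3,6)[of p q r] by (auto simp: left_empty_def not_le[symmetric])
    qed
  qed (use finite_corners finite_left_empty in auto)
  also have "\<dots> \<le> card D"
    by (rule card_mono[OF finD]) (auto simp: D_def h_def corners_def left_empty_def dest: cornerD)
  finally show ?thesis using card_directed_edges by (simp add: D_def)
qed

text \<open>\<open>M\<close> selects the listing that starts at the middle vertex with respect to
  \<open>e\<close>. Since a triangle has only one middle vertex, \<open>M\<close> and its two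
  rotations are disjoint.\<close>

lemma corners_middle:
  fixes e :: "real^2"
  defines "M \<equiv> {(p, q, r). corner p q r \<and> (e \<bullet> (q - p)) * (e \<bullet> (r - p)) < 0}"
  shows "finite M" and "3 * card M \<le> card corners"
proof -
  define rot where "rot = (\<lambda>(p :: real^2, q :: real^2, r :: real^2). (q, r, p))"
  have M: "M \<subseteq> corners" by (auto simp: M_def corners_def)
  show finM: "finite M" using M finite_corners finite_subset by blast
  have rotC: "rot ` C \<subseteq> corners" if "C \<subseteq> corners" for C
    using that corner_rotate by (auto simp: rot_def corners_def)
  have inj: "inj_on rot C" for C by (auto simp: rot_def inj_on_def)
  have card: "card (rot ` C) = card C" for C by (rule card_image[OF inj])
  have k: False if "(y - x) * (z - x) < 0" "(x - y) * (z - y) < 0" for x y z :: real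
    using that by (auto simp: mult_less_0_iff)
  have k2: False if "e \<bullet> (q - p) * (e \<bullet> (r - p)) < 0" "e \<bullet> (p - q) * (e \<bullet> (r - q)) < 0" for p q r
    using k[of "e \<bullet> q" "e \<bullet> p" "e \<bullet> r"] that by (simp add: inner_diff_right)
  have d1: "M \<inter> rot ` M = {}" and d2: "M \<inter> rot ` rot ` M = {}" 
    by (auto simp: M_def rot_def) (metis k2 mult.commute)+
  have d3: "rot ` M \<inter> rot ` rot ` M = {}"
    using d1 image_Int[of rot M "rot ` M"] inj[of UNIV] by simp
  have "3 * card M = card (M \<union> (rot ` M \<union> rot ` rot ` M))"
    using d1 d2 d3 finM by (subst card_Un_disjoint, simp_all add: Int_Un_distrib)
      (subst card_Un_disjoint, simp_all add: card)
  also have "\<dots> \<le> card corners"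
    using M rotC[OF M] rotC[OF rotC[OF M]] by (intro card_mono finite_corners) auto
  finally show "3 * card M \<le> card corners" .
qed

text \<open>\<open>U\<close> and \<open>W\<close> collect the points that are the middle vertex of a
  triangle above and below them. All points but the two extreme ones belong to one of them, and
  points off the hull to both. So \<open>card P - 2\<close> plus the number of points off the hull
  is at most \<open>card M\<close>, and \<open>3 * card M\<close> is bounded through
  \<open>corners\<close>.\<close>

lemma card_triangulation_ge:
  "3 * (card P + card (P - hull_vertices P)) + card left_empty \<le> 2 * card T + 6"
proof -
  obtain e :: "real^2" where e0: "e \<noteq> 0"
    and sep: "\<And>a b. a \<in> P \<Longrightarrow> b \<in> P \<Longrightarrow> a \<noteq> b \<Longrightarrow> e \<bullet> (a - b) \<noteq> 0"
    using separating_direction[OF finite_P] by metis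
  define M where "M = {(p, q, r). corner p q r \<and> (e \<bullet> (q - p)) * (e \<bullet> (r - p)) < 0}"
  define up where "up = {(p, q, r). corner p q r \<and> e \<bullet> (q - p) > 0 \<and> e \<bullet> (r - p) < 0}"
  define dn where "dn = {(p, q, r). corner p q r \<and> e \<bullet> (q - p) < 0 \<and> e \<bullet> (r - p) > 0}"
  define X where "X = {v \<in> P. \<forall>w\<in>P. e \<bullet> (w - v) \<le> 0}"
  define Y where "Y = {v \<in> P. \<forall>w\<in>P. e \<bullet> (w - v) \<ge> 0}"
  define U where "U = fst ` up"
  define W where "W = fst ` dn"
  have M3: "finite M" "3 * card M \<le> card corners"
    using corners_middle[of e] by (simp_all add: M_def)
  have M_eq: "M = up \<union> dn" by (auto simp: M_def up_def dn_def mult_less_0_iff)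
  have fin: "finite up" "finite dn" using M3(1) M_eq by auto
  have "up \<inter> dn = {}" by (auto simp: up_def dn_def)
  hence "card M = card up + card dn" using M_eq fin by (simp add: card_Un_disjoint)
  moreover have "card U \<le> card up" "card W \<le> card dn"
    unfolding U_def W_def using fin by (simp_all add: card_image_le)
  ultimately have UW: "card U + card W \<le> card M" by simp
  have finUW: "finite U" "finite W" using fin by (auto simp: U_def W_def)
  have X1: "card X \<le> 1"
  proof -
    have "a = b" if "a \<in> X" "b \<in> X" for a b
      using that sep[of a b] by (force simp: X_def inner_diff_right)
    thus ?thesis using finite_P by (auto simp: card_le_Suc0_iff_eq X_def)
  qed
  have Y1: "card Y \<le> 1"
  proof -
    have "a = b" if "a \<in> Y" "b \<in> Y" for a b
      using that sep[of a b] by (force simp: Y_def inner_diff_right)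
    thus ?thesis using finite_P by (auto simp: card_le_Suc0_iff_eq Y_def)
  qed
  have XH: "X \<subseteq> hull_vertices P"
    using e0 by (auto simp: X_def hull_vertices_def)
  have YH: "Y \<subseteq> hull_vertices P"
  proof
    fix v assume "v \<in> Y"
    hence "v \<in> P" "\<forall>w\<in>P. (- e) \<bullet> (w - v) \<le> 0" by (auto simp: Y_def)
    moreover have "- e \<noteq> 0" using e0 by simp
    ultimately show "v \<in> hull_vertices P" unfolding hull_vertices_def by blast
  qed
  have slots: "v \<in> U \<union> W \<and> (v \<notin> hull_vertices P \<longrightarrow> v \<in> U \<and> v \<in> W)" if v: "v \<in> P" "v \<notin> X" "v \<notin> Y" for v
  proof -
    obtain x where x: "x \<in> P" "e \<bullet> (x - v) > 0" using v by (auto simp: X_def not_le)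
    obtain y where y: "y \<in> P" "e \<bullet> (y - v) < 0" using v by (auto simp: Y_def not_le)
    have sep1: "w \<in> P \<Longrightarrow> w \<noteq> v \<Longrightarrow> e \<bullet> (w - v) \<noteq> 0"
      and sep2: "w \<in> P \<Longrightarrow> w \<noteq> v \<Longrightarrow> (- e) \<bullet> (w - v) \<noteq> 0" for w
      using sep[of w v] v by auto
    have hull: "v \<in> hull_vertices P" if "d \<bullet> z > 0 \<or> d \<bullet> z < 0" "\<forall>w\<in>P. d \<bullet> (w - v) \<le> 0" for d z
    proof -
      have "d \<noteq> 0" using that(1) by auto
      thus ?thesis using that(2) v(1) unfolding hull_vertices_def by blast
    qed
    have inU: "v \<in> U" if "corner v b a" "e \<bullet> (b - v) > 0" "e \<bullet> (a - v) < 0" for a b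
      unfolding U_def up_def by (rule image_eqI[of _ _ "(v, b, a)"]) (use that in auto)
    have inW: "v \<in> W" if "corner v b a" "(- e) \<bullet> (b - v) > 0" "(- e) \<bullet> (a - v) < 0" for a b
      unfolding W_def dn_def by (rule image_eqI[of _ _ "(v, b, a)"]) (use that in auto)
    have up: "v \<in> U \<or> (\<exists>d a b. d \<bullet> perp e > 0 \<and> (\<forall>w\<in>P. d \<bullet> (w - v) \<le> 0) \<and> a \<in> P \<and> b \<in> P \<and>
       e \<bullet> (a - v) < 0 \<and> d \<bullet> (a - v) < 0 \<and> e \<bullet> (b - v) > 0 \<and> d \<bullet> (b - v) < 0)"
      using upper_corner_or_support[OF v(1) sep1 x y] inU by blast
    have "(- e) \<bullet> (y - v) > 0" "(- e) \<bullet> (x - v) < 0" using x y by auto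
    from upper_corner_or_support[OF v(1) sep2 y(1) this(1) x(1) this(2)]
    have "v \<in> W \<or> (\<exists>d. d \<bullet> perp (- e) > 0 \<and> (\<forall>w\<in>P. d \<bullet> (w - v) \<le> 0))"
      using inW by blast
    hence dn: "v \<in> W \<or> (\<exists>d. d \<bullet> perp e < 0 \<and> (\<forall>w\<in>P. d \<bullet> (w - v) \<le> 0))"
      by (simp add: perp_uminus)
    have "v \<in> U \<union> W"
    proof (rule ccontr)
      assume "\<not> ?thesis"
      then obtain f g a b where f: "f \<bullet> perp e > 0" and P: "a \<in> P" "b \<in> P"
        and a: "e \<bullet> (a - v) < 0" "f \<bullet> (a - v) < 0" and b: "e \<bullet> (b - v) > 0" "f \<bullet> (b - v) < 0"
        and g: "g \<bullet> perp e < 0" "\<And>w. w \<in> P \<Longrightarrow> g \<bullet> (w - v) \<le> 0"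
        using up dn by blast
      \<comment> \<open>If \<open>v\<close> had no triangle above or below, there would be an upper
        normal \<open>f\<close> and a lower normal \<open>g\<close>. This positive combination
        cancels their vertical parts. It is horizontal and yet negative towards both
        \<open>a\<close> on the left and \<open>b\<close> on the right.\<close>
      define x where "x = (- (g \<bullet> perp e)) *\<^sub>R f + (f \<bullet> perp e) *\<^sub>R g"
      have xp: "x \<bullet> perp e = 0" unfolding x_def inner_add_left inner_scaleR_left by simp
      have neg: "x \<bullet> (w - v) < 0" if "f \<bullet> (w - v) < 0" "w \<in> P" for w
      proof -
        have "(- (g \<bullet> perp e)) * (f \<bullet> (w - v)) < 0" using g that by (intro mult_pos_neg) auto
        moreover have "(f \<bullet> perp e) * (g \<bullet> (w - v)) \<le> 0" using f g(2)[OF that(2)] by (intro mult_nonneg_nonpos) auto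
        ultimately show ?thesis unfolding x_def inner_add_left inner_scaleR_left by linarith
      qed
      have ee: "e \<bullet> e > 0" using e0 by simp
      have "(x \<bullet> e) * (e \<bullet> (w - v)) < 0" if "f \<bullet> (w - v) < 0" "w \<in> P" for w
        using inner_perp_expand[of x "w - v" e] xp mult_neg_pos[OF neg[OF that] ee] by simp
      from this[OF a(2) P(1)] this[OF b(2) P(2)] show False
        using a(1) b(1) by (auto simp: mult_less_0_iff)
    qed
    moreover have "v \<in> U \<and> v \<in> W" if "v \<notin> hull_vertices P"
      using up dn hull that by blast
    ultimately show ?thesis by blast
  qed
  have "P - hull_vertices P \<subseteq> U \<inter> W"
    using slots XH YH by blast
  hence "card (P - hull_vertices P) \<le> card (U \<inter> W)"
    using finUW by (intro card_mono) auto
  moreover have "card P \<le> card (U \<union> W) + 2"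
  proof -
    have "P \<subseteq> (U \<union> W) \<union> (X \<union> Y)" using slots by blast
    hence "card P \<le> card ((U \<union> W) \<union> (X \<union> Y))"
      using finUW finite_P by (intro card_mono) (auto simp: X_def Y_def)
    also have "\<dots> \<le> card (U \<union> W) + (card X + card Y)"
      by (meson card_Un_le add_left_mono order_trans)
    finally show ?thesis using X1 Y1 by simp
  qed
  moreover have "card U + card W = card (U \<union> W) + card (U \<inter> W)"
    by (rule card_Un_Int[OF finUW])
  ultimately have "card P + card (P - hull_vertices P) \<le> card M + 2" using UW by linarith
  thus ?thesis using M3(2) card_corners_le unfolding distrib_left by linarith
qed

end

text \<open>The hypothesis \<open>sat\<close> is saturation expressed for edge sets: two
  crossing-free sets that cover the union cannot enlarge it.\<close>

lemma card_Un_triangulations: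
  assumes T: "triangulation P T" and T': "triangulation P T'"
    and sat: "\<And>A B. \<lbrakk>plane_on P A; plane_on P B; T \<union> T' \<subseteq> A \<union> B\<rbrakk> \<Longrightarrow> A \<union> B \<subseteq> T \<union> T'"
  shows "3 * card P \<le> card (T \<union> T') + 6"
proof -
  interpret t: triang P T by standard (rule T)
  interpret t': triang P T' by standard (rule T')
  have unflip: "\<not> plane_on P (insert {a, b} (T1 - {{u, v}}))"
    if T12: "triangulation P T1" "triangulation P T2" "T1 \<union> T2 = T \<union> T'"
      and uv: "{u, v} \<in> T1 \<inter> T2" and X: "crosses a b u v" for T1 T2 a b u v
  proof
    assume "plane_on P (insert {a, b} (T1 - {{u, v}}))"
    moreover have pl: "plane_on P T1" "plane_on P T2" using T12 by (auto simp: triangulation_def)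
    \<comment> \<open>The flipped edge is still present in the other set, so exchanging it loses
      nothing from the union.\<close>
    moreover have "T \<union> T' \<subseteq> insert {a, b} (T1 - {{u, v}}) \<union> T2" using T12(3) uv by blast
    ultimately have "{a, b} \<in> T1 \<union> T2" using sat T12(3) by blast
    thus False using pl uv X by (auto simp: plane_on_def)
  qed
  define S where "S = T \<inter> T'"
  have "card S \<le> card t.left_empty + 3 * card (P - hull_vertices P)"
    using unflip[OF T T'] by (intro t.card_unflippable_le) (auto simp: S_def)
  moreover have "card S \<le> card t'.left_empty + 3 * card (P - hull_vertices P)"
    using unflip[OF T' T] by (intro t'.card_unflippable_le) (auto simp: S_def Un_commute)
  moreover have "card T + card T' = card (T \<union> T') + card S"
    unfolding S_def by (rule card_Un_Int[OF t.finite_T t'.finite_T])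
  \<comment> \<open>Adding the two lower bounds and the two bounds on \<open>card S\<close>, the
    hull edges and the points off the hull cancel. Hence \<open>left_empty\<close> never has to be
    compared with \<open>hull_vertices\<close>.\<close>
  ultimately show ?thesis
    using t.card_triangulation_ge t'.card_triangulation_ge unfolding distrib_left by linarith
qed

subsection \<open>Drawings as plane edge sets\<close>

lemma collinear_if_ori_0:
  assumes "ori a b c = 0"
  shows "collinear {a, b, c}"
proof (cases "a = b")
  case False
  obtain g where "c = (1 - g) *\<^sub>R a + g *\<^sub>R b" using ori_eq_0_param[OF assms False] .
  hence "c - a = g *\<^sub>R (b - a)" by (simp add: algebra_simps)
  hence "collinear {0, b - a, c - a}" unfolding collinear_lemma by blast
  hence "collinear {b, a, c}" by (simp add: collinear_3[of b a c])
  thus ?thesis by (simp add: insert_commute)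
qed simp

lemma gen_pos_image:
  assumes "straight_line_drawing V E p"
  shows "gen_pos (p ` V)"
  using assms unfolding gen_pos_def straight_line_drawing_def simple_graph_def
  by (auto dest!: collinear_if_ori_0) (metis)

text \<open>The edges have to be distinct: an edge meets itself in its relative interior, while
  \<open>crosses\<close> never holds of an edge and itself.\<close>

lemma edges_cross_iff_crosses:
  assumes gp: "gen_pos (p ` V)" and inj: "inj_on p V"
    and V: "a \<in> V" "b \<in> V" "c \<in> V" "d \<in> V" and ne: "a \<noteq> b" "c \<noteq> d" "{a, b} \<noteq> {c, d}"
  shows "edges_cross p {a, b} {c, d} \<longleftrightarrow> crosses (p a) (p b) (p c) (p d)"
proof -
  have pne: "p a \<noteq> p b" "p c \<noteq> p d" using inj V ne by (auto simp: inj_on_def)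
  have pd: "{p a, p b} \<noteq> {p c, p d}"
    using inj V ne by (auto simp: doubleton_eq_iff inj_on_eq_iff)
  have "crosses (p a) (p b) (p c) (p d)" if meet: "open_segment (p a) (p b) \<inter> open_segment (p c) (p d) \<noteq> {}"
  proof -
    obtain z where "z \<in> open_segment (p a) (p b)" "z \<in> open_segment (p c) (p d)" using meet by blast
    then obtain s t where "0 < s" "s < 1" "0 < t" "t < 1"
      "(1 - s) *\<^sub>R p a + s *\<^sub>R p b = (1 - t) *\<^sub>R p c + t *\<^sub>R p d"
      by (auto simp: in_segment)
    thus ?thesis using open_segments_imp_crosses[OF gp _ _ _ _ pd] V pne by blast
  qed
  thus ?thesis
    using edges_cross_pair[of p a b c d] pne crosses_imp_open_segments by blast
qed

lemma inj_on_image_edges: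
  assumes "inj_on p V" "\<forall>e\<in>E. e \<subseteq> V"
  shows "inj_on ((`) p) E"
  using assms by (meson inj_onI inj_on_image_eq_iff)

lemma plane_on_colour_class:
  assumes D: "straight_line_drawing V E p"
    and \<phi>: "\<And>e e'. \<lbrakk>e \<in> F; e' \<in> F; e \<noteq> e'\<rbrakk> \<Longrightarrow> \<not> edges_cross p e e'" and F: "F \<subseteq> E"
  shows "plane_on (p ` V) ((`) p ` F)"
  unfolding plane_on_def
proof (intro conjI allI impI)
  have gp: "gen_pos (p ` V)" by (rule gen_pos_image[OF D])
  have inj: "inj_on p V" and G: "\<forall>e\<in>E. e \<subseteq> V \<and> card e = 2"
    using D by (auto simp: straight_line_drawing_def simple_graph_def)
  have edge: "\<exists>u v. e = {u, v} \<and> u \<in> V \<and> v \<in> V \<and> u \<noteq> v" if "e \<in> F" for e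
    using G F that by (metis card_2_iff insert_subset subset_eq)
  show "(`) p ` F \<subseteq> edges_on (p ` V)"
  proof
    fix e' assume "e' \<in> (`) p ` F"
    then obtain u v where "e' = p ` {u, v}" "u \<in> V" "v \<in> V" "u \<noteq> v" using edge by blast
    thus "e' \<in> edges_on (p ` V)" using inj by (auto simp: edges_on_pair inj_on_def)
  qed
  fix a b c d assume "{a, b} \<in> (`) p ` F" "{c, d} \<in> (`) p ` F"
  then obtain e f where e: "e \<in> F" "{a, b} = p ` e" and f: "f \<in> F" "{c, d} = p ` f" by blast
  obtain u v where uv: "e = {u, v}" "u \<in> V" "v \<in> V" "u \<noteq> v" using edge[OF e(1)] by blast
  obtain x y where xy: "f = {x, y}" "x \<in> V" "y \<in> V" "x \<noteq> y" using edge[OF f(1)] by blast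
  have ab: "{a, b} = {p u, p v}" and cd: "{c, d} = {p x, p y}" using e f uv xy by auto
  have "\<not> crosses (p u) (p v) (p x) (p y)"
  proof (cases "e = f")
    case True
    thus ?thesis using uv xy by (auto simp: doubleton_eq_iff crosses_def)
  next
    case False
    thus ?thesis using \<phi>[OF e(1) f(1)] edges_cross_iff_crosses[OF gp inj] uv xy by blast
  qed
  thus "\<not> crosses a b c d"
    using ab cd by (auto simp: doubleton_eq_iff crosses_swap crosses_swap2)
qed

lemma theta2_drawing_if_plane_cover:
  assumes D: "straight_line_drawing V E p"
    and A: "plane_on (p ` V) A" and B: "plane_on (p ` V) B" and cover: "(`) p ` E \<subseteq> A \<union> B"
  shows "theta2_drawing V E p"
  unfolding theta2_drawing_def
\<comment> \<open>Edges in both sets receive colour 1; those of colour 2 lie in \<open>B\<close>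
  because the sets cover.\<close>
proof (intro conjI exI[of _ "\<lambda>e. if p ` e \<in> A then 1 else 2"] ballI impI)
  have gp: "gen_pos (p ` V)" by (rule gen_pos_image[OF D])
  have inj: "inj_on p V" and G: "\<forall>e\<in>E. e \<subseteq> V \<and> card e = 2"
    using D by (auto simp: straight_line_drawing_def simple_graph_def)
  have edge: "\<exists>u v. e = {u, v} \<and> u \<in> V \<and> v \<in> V \<and> u \<noteq> v" if "e \<in> E" for e
    using G that by (metis card_2_iff insert_subset)
  show "straight_line_drawing V E p" by fact
  show "(\<lambda>e. if p ` e \<in> A then 1 else 2) ` E \<subseteq> {1, 2 :: nat}" by auto
  fix e f assume e: "e \<in> E" and f: "f \<in> E"
    and same: "e \<noteq> f \<and> (if p ` e \<in> A then 1 else 2 :: nat) = (if p ` f \<in> A then 1 else 2)"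
  obtain u v where uv: "e = {u, v}" "u \<in> V" "v \<in> V" "u \<noteq> v" using edge[OF e] by blast
  obtain x y where xy: "f = {x, y}" "x \<in> V" "y \<in> V" "x \<noteq> y" using edge[OF f] by blast
  have "(p ` e \<in> A \<and> p ` f \<in> A) \<or> (p ` e \<in> B \<and> p ` f \<in> B)"
    using same e f cover by (auto split: if_splits)
  hence "\<not> crosses (p u) (p v) (p x) (p y)"
    using A B uv xy by (auto simp: plane_on_def)
  thus "\<not> edges_cross p e f"
    using edges_cross_iff_crosses[OF gp inj, of u v x y] uv xy same by blast
qed

theorem theorem3p1:
  fixes V :: "'a set" and E :: "'a set set" and p :: "'a \<Rightarrow> real^2" and n :: nat
  assumes "n \<ge> 3"
    and "card V = n"
    and "saturated_theta2_drawing V E p"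
  shows "card E \<ge> 3 * n - 6"
proof -
  have sat: "\<And>u v. \<lbrakk>u \<in> V; v \<in> V; u \<noteq> v; theta2_drawing V (insert {u, v} E) p\<rbrakk> \<Longrightarrow> {u, v} \<in> E"
    and draw: "theta2_drawing V E p"
    using assms(3) unfolding saturated_theta2_drawing_def by blast+
  have D: "straight_line_drawing V E p" using draw by (simp add: theta2_drawing_def)
  obtain \<phi> :: "'a set \<Rightarrow> nat" where \<phi>: "\<phi> ` E \<subseteq> {1, 2}"
    "\<forall>e\<in>E. \<forall>e'\<in>E. e \<noteq> e' \<and> \<phi> e = \<phi> e' \<longrightarrow> \<not> edges_cross p e e'"
    using draw unfolding theta2_drawing_def by (elim conjE exE) (rule that)
  have gp: "gen_pos (p ` V)" by (rule gen_pos_image[OF D])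
  have inj: "inj_on p V" and G: "finite V" "\<forall>e\<in>E. e \<subseteq> V \<and> card e = 2"
    using D by (auto simp: straight_line_drawing_def simple_graph_def)
  \<comment> \<open>Saturation is used here: an edge of \<open>A\<close> or \<open>B\<close> can be
    added to the drawing, since the two sets still cover all edges, so it was already there.\<close>
  have closed: "A \<union> B \<subseteq> (`) p ` E"
    if A: "plane_on (p ` V) A" and B: "plane_on (p ` V) B" and cover: "(`) p ` E \<subseteq> A \<union> B" for A B
  proof
    fix e assume e: "e \<in> A \<union> B"
    hence "e \<in> edges_on (p ` V)" using A B by (auto simp: plane_on_def)
    then obtain u v where uv: "e = p ` {u, v}" "u \<in> V" "v \<in> V" "u \<noteq> v"
      by (auto simp: edges_on_def)
    have "straight_line_drawing V (insert {u, v} E) p"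
      using D uv by (auto simp: straight_line_drawing_def simple_graph_def)
    moreover have "(`) p ` insert {u, v} E \<subseteq> A \<union> B" using cover e uv by auto
    ultimately have "theta2_drawing V (insert {u, v} E) p"
      by (rule theta2_drawing_if_plane_cover[OF _ A B])
    hence "{u, v} \<in> E" by (rule sat[OF uv(2-4)])
    thus "e \<in> (`) p ` E" unfolding uv(1) by (rule imageI)
  qed
  define E1 where "E1 = {e \<in> E. \<phi> e = 1}"
  define E2 where "E2 = {e \<in> E. \<phi> e = 2}"
  have E12: "E = E1 \<union> E2" using \<phi>(1) by (auto simp: E1_def E2_def)
  have "plane_on (p ` V) ((`) p ` E1)" "plane_on (p ` V) ((`) p ` E2)"
    by (rule plane_on_colour_class[OF D]; use \<phi>(2) in \<open>force simp: E1_def E2_def\<close>)+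
  \<comment> \<open>Each colour class is extended separately; by \<open>closed\<close> the
    extensions add no edge to the drawing.\<close>
  then obtain T T' where T: "(`) p ` E1 \<subseteq> T" "triangulation (p ` V) T"
    and T': "(`) p ` E2 \<subseteq> T'" "triangulation (p ` V) T'"
    using triangulation_exists[OF gp] by metis
  have cover: "(`) p ` E \<subseteq> T \<union> T'" using T(1) T'(1) E12 by blast
  have "plane_on (p ` V) T" "plane_on (p ` V) T'"
    using T(2) T'(2) by (simp_all add: triangulation_def)
  from closed[OF this cover] cover have eq: "T \<union> T' = (`) p ` E" by (rule equalityI)
  have "3 * card (p ` V) \<le> card (T \<union> T') + 6"
    by (rule card_Un_triangulations[OF T(2) T'(2)]) (unfold eq, rule closed)
  moreover have "card (p ` V) = n" using inj assms(2) by (simp add: card_image)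
  moreover have "card ((`) p ` E) = card E"
    using inj_on_image_edges[OF inj] G by (intro card_image) auto
  ultimately show ?thesis using eq by simp
qed

end
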